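(* Let $c=\sqrt5+5$, $\delta=(c-3)/c$ and $\varepsilon=1/2$. For every join-tree $A$ over $P_\infty$, every finite set $S\subseteq\mathbb Z$, and every component $K=P_{i,j}$ of $\langle A\rangle|S$ of length $k=j-i$: \[\Phi(A|S)\ge\log_c(\varepsilon\delta k)+\Delta(\langle A\rangle\ominus(S\cup V(P_{i,j})))\ \text{ if $K$ is open},\] \[\Phi(A|S)\ge\log_c(\delta k)+\Delta(\langle A\rangle\ominus(S\cup V(P_{i,j})))\ \text{ if $K$ is half-open},\] \[\Phi(A|S)\ge\log_c(k)+\Delta(\langle A\rangle\ominus(S\cup V(P_{i,j})))\ \text{ if $K$ is closed}.\]
   Context: $P_\infty$ is the graph with vertex set $\mathbb Z$ and edges $\{i,i+1\}$, $i\in\mathbb Z$, with the constant weighting $\theta\equiv1$; for a finite subgraph $F$ (subgraphs have no isolated vertices), $\Delta(F)=|V(F)|-|E(F)|$. For integers $i<j$, $P_{i,j}$ is the path with edges $\{i,i+1\},\dots,\{j-1,j\}$. For a vertex set $S$, $F\ominus S$ is the union of the components of $F$ vertex-disjoint from $S$, and $\Delta(F|S):=\Delta(F\ominus S)$. Components of $F|S$: the paths $P_{i,j}\subseteq F$ ($i<j$) with $V(P_{i,j})\cap S\subseteq\{i,j\}$ such that $\{i-1,i\}\notin E(F)$ if $i\notin S$ and $\{j,j+1\}\notin E(F)$ if $j\notin S$. Such a component is open if $i,j\in S$, half-open if exactly one of $i,j$ lies in $S$, closed if neither does; its length is $j-i$. Join-trees: finite rooted binary trees (non-leaf nodes have two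 ordered children) whose leaves are labeled by edges of $P_\infty$ or $\bot$; $\langle A\rangle$ is the subgraph formed by the edge labels, $V(A)=V(\langle A\rangle)$; components of $A|S$ are those of $\langle A\rangle|S$; $\Delta(A|S)=\Delta(\langle A\rangle\ominus S)$. $[B,C]$ is the join-tree whose root has children $B,C$; one-node join-trees are atomic. $D\preceq A$ if $D$ is the one-node $\bot$-labeled tree, or $D=A$, or $D\preceq$ a child of $A$; $D\prec A$ if $D\preceq A$, $D\neq A$. $\Phi(A|S)$ (for join-trees $A$ and finite $S\subseteq\mathbb Z$) is the pointwise minimal function to $\mathbb R_{\ge0}$ satisfying for all $S,A,B,C,D$: (i) $\Phi(A|S)\ge\Phi(B|S)+\Delta(C|S\cup V(B))$ if $A\in\{[B,C],[C,B]\}$; (ii) $\Phi(A|S)\ge\Delta(B|S)+\Phi(C|S\cup V(B))$ if $A\in\{[B,C],[C,B]\}$; (iii) $\Phi(A|S)\ge\frac12(\Phi(D|S)+\Phi(A|S\cup V(D))+\Delta(A|S))$ if $D\prec A$. (For atomic $A$, $\Phi(A|S)=\Delta(A|S)$.) *)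

theory Defs
  imports Complex_Main
begin

text \<open>A graph without isolated vertices is given by its set of edges, each edge being the set of
  its two end vertices.\<close>

definition verts :: "'v set set \<Rightarrow> 'v set" where
  "verts F = \<Union>F"

definition Delta :: "'v set set \<Rightarrow> real" where
  "Delta F = real (card (verts F)) - real (card F)"

definition connected_in :: "'v set set \<Rightarrow> 'v \<Rightarrow> 'v \<Rightarrow> bool" where
  "connected_in F u v \<longleftrightarrow> (u, v) \<in> {(x, y). {x, y} \<in> F}\<^sup>*"

text \<open>\<open>F \<ominus> S\<close> keeps an edge iff no vertex of the component containing it lies in \<open>S\<close>.\<close>

definition minus_comps :: "'v set set \<Rightarrow> 'v set \<Rightarrow> 'v set set" (infixl "\<ominus>" 65) where
  "F \<ominus> S = {e \<in> F. \<forall>u\<in>e. \<forall>v. connected_in F u v \<longrightarrow> v \<notin> S}"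

definition Delta_on :: "'v set set \<Rightarrow> 'v set \<Rightarrow> real" where
  "Delta_on F S = Delta (F \<ominus> S)"

definition P_edge :: "int \<Rightarrow> int set" where
  "P_edge i = {i, i + 1}"

definition P_path :: "int \<Rightarrow> int \<Rightarrow> int set set" where
  "P_path i j = P_edge ` {i..<j}"

definition path_component :: "int set set \<Rightarrow> int set \<Rightarrow> int \<Rightarrow> int \<Rightarrow> bool" where
  "path_component F S i j \<longleftrightarrow>
     i < j \<and> P_path i j \<subseteq> F \<and> verts (P_path i j) \<inter> S \<subseteq> {i, j} \<and>
     (i \<notin> S \<longrightarrow> {i - 1, i} \<notin> F) \<and> (j \<notin> S \<longrightarrow> {j, j + 1} \<notin> F)"

definition open_component :: "int set set \<Rightarrow> int set \<Rightarrow> int \<Rightarrow> int \<Rightarrow> bool" where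
  "open_component F S i j \<longleftrightarrow> path_component F S i j \<and> i \<in> S \<and> j \<in> S"

definition half_open_component :: "int set set \<Rightarrow> int set \<Rightarrow> int \<Rightarrow> int \<Rightarrow> bool" where
  "half_open_component F S i j \<longleftrightarrow> path_component F S i j \<and> (i \<in> S) \<noteq> (j \<in> S)"

definition closed_component :: "int set set \<Rightarrow> int set \<Rightarrow> int \<Rightarrow> int \<Rightarrow> bool" where
  "closed_component F S i j \<longleftrightarrow> path_component F S i j \<and> i \<notin> S \<and> j \<notin> S"

text \<open>Join-trees over the two-way infinite path. The label \<open>Some i\<close> stands for the edge
  \<open>P_edge i\<close>, that is \<open>{i, i + 1}\<close>, and \<open>None\<close> for the label \<open>\<bottom>\<close>.\<close>

datatype jtree = Atom "int option" | Join jtree jtree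

primrec graph_of :: "jtree \<Rightarrow> int set set" where
  "graph_of (Atom l) = P_edge ` set_option l"
| "graph_of (Join B C) = graph_of B \<union> graph_of C"

definition verts_of :: "jtree \<Rightarrow> int set" where
  "verts_of A = verts (graph_of A)"

inductive subtree :: "jtree \<Rightarrow> jtree \<Rightarrow> bool" (infix "\<preceq>" 50) where
  bot: "Atom None \<preceq> A"
| refl: "A \<preceq> A"
| left: "D \<preceq> B \<Longrightarrow> D \<preceq> Join B C"
| right: "D \<preceq> C \<Longrightarrow> D \<preceq> Join B C"

definition strict_subtree :: "jtree \<Rightarrow> jtree \<Rightarrow> bool" (infix "\<prec>" 50) where
  "D \<prec> A \<longleftrightarrow> D \<preceq> A \<and> D \<noteq> A"

definition admissible :: "(jtree \<Rightarrow> int set \<Rightarrow> real) \<Rightarrow> bool" where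
  "admissible \<phi> \<longleftrightarrow>
     (\<forall>A S. finite S \<longrightarrow> 0 \<le> \<phi> A S) \<and>
     (\<forall>A B C S. finite S \<longrightarrow> A \<in> {Join B C, Join C B} \<longrightarrow>
        \<phi> A S \<ge> \<phi> B S + Delta_on (graph_of C) (S \<union> verts_of B)) \<and>
     (\<forall>A B C S. finite S \<longrightarrow> A \<in> {Join B C, Join C B} \<longrightarrow>
        \<phi> A S \<ge> Delta_on (graph_of B) S + \<phi> C (S \<union> verts_of B)) \<and>
     (\<forall>A D S. finite S \<longrightarrow> D \<prec> A \<longrightarrow>
        \<phi> A S \<ge> 1 / 2 * (\<phi> D S + \<phi> A (S \<union> verts_of D) + Delta_on (graph_of A) S))"

text \<open>The pointwise infimum of the admissible functions. It is itself admissible, hence the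
  pointwise minimal admissible function: see \<open>admissible_Phi\<close> and \<open>Phi_le\<close> below.
  Only its values at finite \<open>S\<close> are meaningful.\<close>

definition Phi :: "jtree \<Rightarrow> int set \<Rightarrow> real" where
  "Phi A S = Inf {\<phi> A S | \<phi>. admissible \<phi>}"

primrec edge_leaves :: "jtree \<Rightarrow> nat" where
  "edge_leaves (Atom l) = (case l of None \<Rightarrow> 0 | Some i \<Rightarrow> 1)"
| "edge_leaves (Join B C) = edge_leaves B + edge_leaves C"

primrec crude_bound :: "jtree \<Rightarrow> nat" where
  "crude_bound (Atom l) = (case l of None \<Rightarrow> 0 | Some i \<Rightarrow> 2)"
| "crude_bound (Join B C) =
     crude_bound B + crude_bound C + 2 * edge_leaves B + 2 * edge_leaves C"

lemma verts_of_simps [simp]: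
  "verts_of (Atom None) = {}" "verts_of (Atom (Some i)) = {i, i + 1}" "verts_of (Join B C) = verts_of B \<union> verts_of C"
  by (auto simp: verts_of_def verts_def P_edge_def)

lemma finite_verts_of [simp]: "finite (verts_of A)"
proof (induction A)
  case (Atom l)
  then show ?case by (cases l) auto
qed auto

lemma card_verts_of_le: "card (verts_of A) \<le> 2 * edge_leaves A"
proof (induction A)
  case (Atom l)
  then show ?case by (cases l) auto
next
  case (Join B C)
  then show ?case using card_Un_le[of "verts_of B" "verts_of C"] by simp
qed

lemma Delta_on_le: "Delta_on (graph_of A) S \<le> real (2 * edge_leaves A)"
proof -
  have "verts (graph_of A \<ominus> S) \<subseteq> verts_of A"
    by (auto simp: verts_of_def verts_def minus_comps_def)
  then have "card (verts (graph_of A \<ominus> S)) \<le> 2 * edge_leaves A"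
    using card_mono[OF finite_verts_of] card_verts_of_le le_trans by blast
  then show ?thesis by (simp add: Delta_on_def Delta_def)
qed

lemma edge_leaves_le: "2 * edge_leaves A \<le> crude_bound A"
proof (induction A)
  case (Atom l)
  then show ?case by (cases l) auto
qed auto

lemma crude_bound_mono: "D \<preceq> A \<Longrightarrow> crude_bound D \<le> crude_bound A"
  by (induction rule: subtree.induct) auto

lemma crude_bound_strict:
  assumes "D \<prec> A"
  shows "crude_bound D + 2 * edge_leaves A \<le> crude_bound A"
proof -
  have "D \<preceq> A" "D \<noteq> A" using assms by (auto simp: strict_subtree_def)
  then show ?thesis
  proof (cases rule: subtree.cases)
    case bot
    then show ?thesis using edge_leaves_le[of A] by simp
  next
    case refl
    then show ?thesis using \<open>D \<noteq> A\<close> by simp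
  next
    case (left B C)
    then show ?thesis using edge_leaves_le[of B] crude_bound_mono[of D B] by simp
  next
    case (right C B)
    then show ?thesis using edge_leaves_le[of C] crude_bound_mono[of D C] by simp
  qed
qed

lemma admissible_crude_bound: "admissible (\<lambda>A S. real (crude_bound A))"
proof -
  have 1: "real (crude_bound B) + Delta_on (graph_of C) T \<le> real (crude_bound A)"
    "Delta_on (graph_of B) T + real (crude_bound C) \<le> real (crude_bound A)"
    if "A \<in> {Join B C, Join C B}" for A B C T
    using that Delta_on_le[of B T] Delta_on_le[of C T] by auto
  have 2: "1 / 2 * (real (crude_bound D) + real (crude_bound A) + Delta_on (graph_of A) T)
      \<le> real (crude_bound A)" if "D \<prec> A" for A D T
  proof -
    have "real (crude_bound D) + real (2 * edge_leaves A) \<le> real (crude_bound A)"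
      using crude_bound_strict[OF that] by linarith
    then show ?thesis using Delta_on_le[of A T] by (simp add: field_simps)
  qed
  show ?thesis
    unfolding admissible_def by (intro conjI allI impI of_nat_0_le_iff 1 2)
qed

lemma admissibleD:
  assumes "admissible \<phi>" "finite S"
  shows "0 \<le> \<phi> A S"
    and "A \<in> {Join B C, Join C B} \<Longrightarrow>
      \<phi> B S + Delta_on (graph_of C) (S \<union> verts_of B) \<le> \<phi> A S"
    and "A \<in> {Join B C, Join C B} \<Longrightarrow>
      Delta_on (graph_of B) S + \<phi> C (S \<union> verts_of B) \<le> \<phi> A S"
    and "D \<prec> A \<Longrightarrow>
      1 / 2 * (\<phi> D S + \<phi> A (S \<union> verts_of D) + Delta_on (graph_of A) S) \<le> \<phi> A S"
proof -
  note conds = assms(1)[unfolded admissible_def]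
  show "0 \<le> \<phi> A S"
    by (rule conds[THEN conjunct1, rule_format, OF assms(2)])
  show "A \<in> {Join B C, Join C B} \<Longrightarrow>
      \<phi> B S + Delta_on (graph_of C) (S \<union> verts_of B) \<le> \<phi> A S"
    by (rule conds[THEN conjunct2, THEN conjunct1, rule_format, OF assms(2)])
  show "A \<in> {Join B C, Join C B} \<Longrightarrow>
      Delta_on (graph_of B) S + \<phi> C (S \<union> verts_of B) \<le> \<phi> A S"
    by (rule conds[THEN conjunct2, THEN conjunct2, THEN conjunct1, rule_format, OF assms(2)])
  show "D \<prec> A \<Longrightarrow>
      1 / 2 * (\<phi> D S + \<phi> A (S \<union> verts_of D) + Delta_on (graph_of A) S) \<le> \<phi> A S"
    by (rule conds[THEN conjunct2, THEN conjunct2, THEN conjunct2, rule_format, OF assms(2)])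
qed

lemma Phi_le:
  assumes "admissible \<phi>" "finite S"
  shows "Phi A S \<le> \<phi> A S"
  unfolding Phi_def
proof (rule cInf_lower)
  show "\<phi> A S \<in> {\<phi> A S |\<phi>. admissible \<phi>}" using assms(1) by blast
  show "bdd_below {\<phi> A S |\<phi>. admissible \<phi>}"
    using admissibleD(1) assms(2) by (intro bdd_belowI[of _ 0]) blast
qed

lemma Phi_greatest:
  assumes "\<And>\<phi>. admissible \<phi> \<Longrightarrow> b \<le> \<phi> A S"
  shows "b \<le> Phi A S"
  unfolding Phi_def using assms admissible_crude_bound by (intro cInf_greatest) blast+

lemma admissible_Phi: "admissible Phi"
  unfolding admissible_def
proof (intro conjI allI impI)
  fix A :: jtree and S :: "int set"
  assume "finite S"
  then show "0 \<le> Phi A S" using Phi_greatest admissibleD(1) by blast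
next
  fix A B C :: jtree and S :: "int set"
  assume S: "finite S" and A: "A \<in> {Join B C, Join C B}"
  show "Phi B S + Delta_on (graph_of C) (S \<union> verts_of B) \<le> Phi A S"
  proof (rule Phi_greatest)
    fix \<phi> assume "admissible \<phi>"
    then have "\<phi> B S + Delta_on (graph_of C) (S \<union> verts_of B) \<le> \<phi> A S"
      using admissibleD(2)[OF _ S A] by blast
    then show "Phi B S + Delta_on (graph_of C) (S \<union> verts_of B) \<le> \<phi> A S"
      using Phi_le[OF \<open>admissible \<phi>\<close> S, of B] by linarith
  qed
next
  fix A B C :: jtree and S :: "int set"
  assume S: "finite S" and A: "A \<in> {Join B C, Join C B}"
  show "Delta_on (graph_of B) S + Phi C (S \<union> verts_of B) \<le> Phi A S"
  proof (rule Phi_greatest)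
    fix \<phi> assume "admissible \<phi>"
    then have "Delta_on (graph_of B) S + \<phi> C (S \<union> verts_of B) \<le> \<phi> A S"
      using admissibleD(3)[OF _ S A] by blast
    then show "Delta_on (graph_of B) S + Phi C (S \<union> verts_of B) \<le> \<phi> A S"
      using Phi_le[OF \<open>admissible \<phi>\<close>, of "S \<union> verts_of B" C] S by simp
  qed
next
  fix A D :: jtree and S :: "int set"
  assume S: "finite S" and D: "D \<prec> A"
  show "1 / 2 * (Phi D S + Phi A (S \<union> verts_of D) + Delta_on (graph_of A) S) \<le> Phi A S"
  proof (rule Phi_greatest)
    fix \<phi> assume "admissible \<phi>"
    then have "1 / 2 * (\<phi> D S + \<phi> A (S \<union> verts_of D) + Delta_on (graph_of A) S) \<le> \<phi> A S"
      using admissibleD(4)[OF _ S D] by blast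
    then show "1 / 2 * (Phi D S + Phi A (S \<union> verts_of D) + Delta_on (graph_of A) S) \<le> \<phi> A S"
      using Phi_le[OF \<open>admissible \<phi>\<close>, of "S \<union> verts_of D" A] Phi_le[OF \<open>admissible \<phi>\<close> S, of D] S
      by simp
  qed
qed

end

(* Induction over the join-tree. For a join-tree [B,C] a component of length k splits into runs of B
   and gaps, to which the induction hypothesis applies through rules (i) and (ii). Every closed run
   contributes 1 to Delta(B|S), so m closed runs gain a factor c^m for each piece, against about 2m
   pieces. This settles open and half-open components, and closed ones when m >= 2. A closed
   component with m = 1 at every step is treated by descending along the child that contains its
   leftmost edge until the fraction covered drops below 1/phi, phi the golden ratio; rule (iii)
   applied to that child D multiplies the bound for the initial piece by the half-open bound for the
   remainder, and the identity x (1 - x) = phi^-3 at x = 1/phi determines c. *)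

theory Submission imports Defs begin

text \<open>Two constants are at work: \<gamma> = c \<delta>, which the golden ratio fixes as the
  cube of phi, and \<beta> = c. The value of c comes from half-open components with one closed run:
  a closed run of length t, a half-open run of length t / \<gamma> and an open gap of length 2 t /
  \<gamma> add up to (\<gamma> + 3) t / \<gamma>, which one factor c pays for if c = \<gamma> + 3.
  The value 1/2 of \<epsilon> comes from open components without closed runs in either child; two
  half-open runs, one at each end, may cover them. The obstacle is a closed component with m = 1.
  The factor gained is used up by the component's own contribution to Delta, so one join only gives
  the length up to a factor 1 + 1 / \<gamma>, and this loss would compound from level to level. The
  descent therefore measures all lengths against the component of the tree at the top and uses rule
  (iii) once. As that rule has the same tree on its right-hand side, the half-open bound for a tree
  must be settled before its closed one.\<close>

section \<open>Subgraphs of the path as sets of integers\<close>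

primrec edges_of :: "jtree \<Rightarrow> int set" where
  "edges_of (Atom l) = set_option l"
| "edges_of (Join B C) = edges_of B \<union> edges_of C"

definition ends :: "int set \<Rightarrow> int set" where
  "ends E = E \<union> (\<lambda>x. x + 1) ` E"

text \<open>Edges are represented by their left end vertices. The elements of \<open>free_ends E S\<close> are the last
  edges of the components that avoid \<open>S\<close>, hence \<open>\<Delta>(E | S)\<close> is their number.\<close>

definition free_ends :: "int set \<Rightarrow> int set \<Rightarrow> int set" where
  "free_ends E S = {x \<in> E. x + 1 \<notin> E \<and> (\<forall>v\<in>S. v \<le> x + 1 \<longrightarrow> \<not> {v..x} \<subseteq> E)}"

definition interval_comp :: "int set \<Rightarrow> int set \<Rightarrow> int \<Rightarrow> int \<Rightarrow> bool" where
  "interval_comp E S i j \<longleftrightarrow> i < j \<and> {i..<j} \<subseteq> E \<and> S \<inter> {i..j} \<subseteq> {i, j} \<and>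
     (i \<notin> S \<longrightarrow> i - 1 \<notin> E) \<and> (j \<notin> S \<longrightarrow> j \<notin> E)"

lemma graph_of_eq: "graph_of A = P_edge ` edges_of A"
  by (induction A) (auto simp: image_Un)

lemma finite_edges_of [simp]: "finite (edges_of A)"
proof (induction A)
  case (Atom l)
  then show ?case by (cases l) auto
qed auto

lemma verts_of_eq: "verts_of A = ends (edges_of A)"
  by (auto simp: verts_of_def verts_def graph_of_eq P_edge_def ends_def)

lemma P_edge_eq_iff [simp]: "P_edge x = P_edge y \<longleftrightarrow> x = y"
  by (auto simp: P_edge_def doubleton_eq_iff)

lemma P_edge_mem [simp]: "P_edge x \<in> P_edge ` E \<longleftrightarrow> x \<in> E"
  by auto

lemma verts_P_path:
  assumes "i < j"
  shows "verts (P_path i j) = {i..j}"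
proof (intro equalityI subsetI)
  fix x assume x: "x \<in> {i..j}"
  show "x \<in> verts (P_path i j)"
  proof (cases "x = j")
    case True
    then have "j - 1 \<in> {i..<j}" "x \<in> P_edge (j - 1)" using assms by (auto simp: P_edge_def)
    then show ?thesis unfolding verts_def P_path_def by blast
  next
    case False
    then have "x \<in> {i..<j}" "x \<in> P_edge x" using x by (auto simp: P_edge_def)
    then show ?thesis unfolding verts_def P_path_def by blast
  qed
qed (auto simp: verts_def P_path_def P_edge_def)

lemma path_component_iff: "path_component (P_edge ` E) S i j \<longleftrightarrow> interval_comp E S i j"
proof -
  have "P_path i j \<subseteq> P_edge ` E \<longleftrightarrow> {i..<j} \<subseteq> E"
    unfolding P_path_def by (rule inj_image_subset_iff) (simp add: inj_def)
  moreover have "{i - 1, i} = P_edge (i - 1)" "{j, j + 1} = P_edge j"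
    by (auto simp: P_edge_def)
  ultimately show ?thesis
    by (auto simp: path_component_def interval_comp_def verts_P_path)
qed

lemma connected_in_P_edge:
  "connected_in (P_edge ` E) u v \<longleftrightarrow> {min u v..<max u v} \<subseteq> E"
proof
  assume "connected_in (P_edge ` E) u v"
  then have "(u, v) \<in> {(x, y). {x, y} \<in> P_edge ` E}\<^sup>*"
    by (simp add: connected_in_def)
  then show "{min u v..<max u v} \<subseteq> E"
  proof (induction rule: rtrancl_induct)
    case base
    then show ?case by simp
  next
    case (step y z)
    then obtain x where x: "x \<in> E" "{y, z} = {x, x + 1}"
      by (auto simp: P_edge_def)
    then have "{min y z..<max y z} = {x}"
      by (auto simp: doubleton_eq_iff)
    moreover have "{min u z..<max u z} \<subseteq> {min u y..<max u y} \<union> {min y z..<max y z}"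
      by auto
    ultimately show ?case using step.IH x(1) by auto
  qed
next
  have up: "(u, u + int n) \<in> {(x, y). {x, y} \<in> P_edge ` E}\<^sup>*" if "{u..<u + int n} \<subseteq> E" for u n
    using that
  proof (induction n)
    case 0
    then show ?case by simp
  next
    case (Suc n)
    have "{u..<u + int n} \<subseteq> E" "u + int n \<in> E" using Suc.prems by auto
    then have "{u + int n, u + int (Suc n)} \<in> P_edge ` E"
      by (auto simp: P_edge_def algebra_simps intro!: image_eqI[of _ _ "u + int n"])
    then show ?case using Suc.IH[OF \<open>{u..<u + int n} \<subseteq> E\<close>]
      by (auto intro: rtrancl_into_rtrancl)
  qed
  have up': "(u, v) \<in> {(x, y). {x, y} \<in> P_edge ` E}\<^sup>*" if "{u..<v} \<subseteq> E" "u \<le> v" for u v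
    using up[of u "nat (v - u)"] that by simp
  have "sym {(x, y). {x, y} \<in> P_edge ` E}"
    by (auto simp: sym_def insert_commute)
  then have sym: "sym ({(x, y). {x, y} \<in> P_edge ` E}\<^sup>*)"
    by (rule sym_rtrancl)
  assume "{min u v..<max u v} \<subseteq> E"
  then show "connected_in (P_edge ` E) u v"
    unfolding connected_in_def using up'[of u v] up'[of v u] symD[OF sym]
    by (cases "u \<le> v") (auto simp: min_def max_def)
qed

text \<open>Each edge is charged with its left end; the vertices left over are the right ends of the
  components, one for each.\<close>

lemma Delta_P_edge:
  assumes "finite G"
  shows "Delta (P_edge ` G) = real (card {x \<in> G. x + 1 \<notin> G})"
proof -
  have "verts (P_edge ` G) = G \<union> (\<lambda>x. x + 1) ` {x \<in> G. x + 1 \<notin> G}"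
    by (auto simp: verts_def P_edge_def)
  also have "card \<dots> = card G + card ((\<lambda>x. x + 1) ` {x \<in> G. x + 1 \<notin> G})"
    using assms by (intro card_Un_disjoint) auto
  also have "card ((\<lambda>x. x + 1) ` {x \<in> G. x + 1 \<notin> G}) = card {x \<in> G. x + 1 \<notin> G}"
    by (intro card_image) (auto simp: inj_on_def)
  finally show ?thesis
    by (simp add: Delta_def card_image inj_on_def)
qed

lemma Delta_minus_comps:
  assumes "finite E"
  shows "Delta (P_edge ` E \<ominus> S) = real (card (free_ends E S))"
proof -
  \<comment> \<open>The interval spans the edge x and the vertex v, on whichever side of x this
    vertex lies.\<close>
  define G where "G = {x \<in> E. \<forall>v\<in>S. \<not> {min x v..<max (x + 1) v} \<subseteq> E}"
  have conn: "connected_in (P_edge ` E) u v \<longleftrightarrow> {min x v..<max (x + 1) v} \<subseteq> E"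
    if "x \<in> E" "u = x \<or> u = x + 1" for x u v
  proof -
    have "{min u v..<max u v} \<union> {x} = {min x v..<max (x + 1) v}"
      using that(2) by (auto simp: min_def max_def)
    then show ?thesis using that(1) by (auto simp: connected_in_P_edge)
  qed
  have "P_edge ` E \<ominus> S = P_edge ` G"
  proof (rule set_eqI)
    fix e
    show "e \<in> P_edge ` E \<ominus> S \<longleftrightarrow> e \<in> P_edge ` G"
    proof (cases "e \<in> P_edge ` E")
      case True
      then obtain x where x: "x \<in> E" "e = P_edge x" by auto
      have "x \<in> G \<longleftrightarrow> (\<forall>u\<in>P_edge x. \<forall>v. connected_in (P_edge ` E) u v \<longrightarrow> v \<notin> S)"
        using conn[OF x(1)] x(1) by (auto simp: G_def P_edge_def)
      then show ?thesis using x by (auto simp: minus_comps_def)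
    next
      case False
      then show ?thesis by (auto simp: minus_comps_def G_def)
    qed
  qed
  moreover have "{x \<in> G. x + 1 \<notin> G} = free_ends E S"
  proof (rule set_eqI)
    fix x
    show "x \<in> {x \<in> G. x + 1 \<notin> G} \<longleftrightarrow> x \<in> free_ends E S"
    proof (cases "x \<in> E")
      case xE: True
      show ?thesis
      proof (cases "x + 1 \<in> E")
        case True
        have "x + 1 \<in> G" if "x \<in> G"
        proof -
          have "{min x v..<max (x + 1) v} \<subseteq> E" if "{min (x + 1) v..<max (x + 1 + 1) v} \<subseteq> E" for v
          proof -
            have "{min x v..<max (x + 1) v} \<subseteq> {min (x + 1) v..<max (x + 1 + 1) v} \<union> {x}"
              by (auto simp: min_def max_def)
            then show ?thesis using that xE by auto
          qed
          moreover have "\<not> {min x v..<max (x + 1) v} \<subseteq> E" if "v \<in> S" for v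
            using \<open>x \<in> G\<close> that by (simp add: G_def)
          ultimately have "\<forall>v\<in>S. \<not> {min (x + 1) v..<max (x + 1 + 1) v} \<subseteq> E" by blast
          then show ?thesis using True by (simp add: G_def)
        qed
        then show ?thesis using True by (auto simp: free_ends_def)
      next
        case False
        \<comment> \<open>As x + 1 is not in E, no vertex to the right of x + 1 is connected to x,
          and the two-sided condition becomes the one-sided one of \<open>free_ends\<close>.\<close>
        have "{min x v..<max (x + 1) v} \<subseteq> E \<longleftrightarrow> v \<le> x + 1 \<and> {v..x} \<subseteq> E" for v
        proof (cases "v \<le> x + 1")
          case True
          then have "{min x v..<max (x + 1) v} = insert x {v..x}" by (auto simp: min_def max_def)
          then show ?thesis using True xE by auto
        next
          assume "\<not> v \<le> x + 1"
          then have "x + 1 \<in> {min x v..<max (x + 1) v}" by auto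
          then show ?thesis using False \<open>\<not> v \<le> x + 1\<close> by blast
        qed
        then show ?thesis using False xE by (auto simp: G_def free_ends_def)
      qed
    qed (auto simp: G_def free_ends_def)
  qed
  moreover have "finite G" using assms by (auto simp: G_def)
  ultimately show ?thesis by (simp add: Delta_P_edge)
qed

section \<open>Behaviour of Delta under unions and under enlarging S\<close>

lemma finite_free_ends [simp]: "finite E \<Longrightarrow> finite (free_ends E S)"
  by (simp add: free_ends_def)

lemma free_ends_antimono: "S \<subseteq> T \<Longrightarrow> free_ends E T \<subseteq> free_ends E S"
  by (auto simp: free_ends_def)

lemma card_free_ends_antimono:
  "finite E \<Longrightarrow> S \<subseteq> T \<Longrightarrow> card (free_ends E T) \<le> card (free_ends E S)"
  by (simp add: card_mono free_ends_antimono)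

text \<open>A component of E \<union> F that avoids S either has an edge of E, and then it is
  recovered by \<open>?g\<close> from a component of E inside it, which avoids S as well; or it lies
  in F and has no vertex of E.\<close>

lemma card_free_ends_Un:
  assumes "finite E" "finite F"
  shows "card (free_ends (E \<union> F) S) \<le> card (free_ends E S) + card (free_ends F (S \<union> ends E))"
proof -
  let ?g = "\<lambda>e. THE x. e \<le> x \<and> {e..x} \<subseteq> E \<union> F \<and> x + 1 \<notin> E \<union> F"
  have "free_ends (E \<union> F) S \<subseteq> ?g ` free_ends E S \<union> free_ends F (S \<union> ends E)"
  proof
    fix x assume x: "x \<in> free_ends (E \<union> F) S"
    show "x \<in> ?g ` free_ends E S \<union> free_ends F (S \<union> ends E)"
    proof (cases "\<exists>e\<in>E. e \<le> x \<and> {e..x} \<subseteq> E \<union> F")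
      case True
      \<comment> \<open>The largest edge of E that is joined to x from the left ends a component of
        E; it is the preimage of x under \<open>?g\<close>.\<close>
      define M where "M = {e \<in> E. e \<le> x \<and> {e..x} \<subseteq> E \<union> F}"
      define e where "e = Max M"
      have M: "finite M" "M \<noteq> {}" using True assms(1) by (auto simp: M_def)
      have e: "e \<in> E" "e \<le> x" "{e..x} \<subseteq> E \<union> F" using Max_in[OF M] by (auto simp: e_def M_def)
      have max: "f \<le> e" if "f \<in> E" "f \<le> x" "{f..x} \<subseteq> E \<union> F" for f
        using Max_ge[OF M(1), of f] that by (auto simp: e_def M_def)
      have x': "x + 1 \<notin> E \<union> F" "\<And>v. v \<in> S \<Longrightarrow> v \<le> x + 1 \<Longrightarrow> \<not> {v..x} \<subseteq> E \<union> F"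
        using x by (auto simp: free_ends_def)
      have "e + 1 \<notin> E"
      proof
        assume "e + 1 \<in> E"
        moreover have "e + 1 \<le> x" using calculation x'(1) e(2) by (cases "e = x") auto
        moreover have "{e + 1..x} \<subseteq> {e..x}" by auto
        then have "{e + 1..x} \<subseteq> E \<union> F" using e(3) by blast
        ultimately show False using max[of "e + 1"] by simp
      qed
      moreover have "\<not> {v..e} \<subseteq> E" if "v \<in> S" "v \<le> e + 1" for v
      proof
        assume "{v..e} \<subseteq> E"
        moreover have "{v..x} \<subseteq> {v..e} \<union> {e..x}" by auto
        ultimately have "{v..x} \<subseteq> E \<union> F" using e(3) by blast
        then show False using x'(2)[OF that(1)] that(2) e(2) by auto
      qed
      ultimately have "e \<in> free_ends E S" using e(1) by (auto simp: free_ends_def)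
      moreover have "?g e = x"
      proof (rule the_equality)
        show "e \<le> x \<and> {e..x} \<subseteq> E \<union> F \<and> x + 1 \<notin> E \<union> F" using e x'(1) by blast
        fix y assume y: "e \<le> y \<and> {e..y} \<subseteq> E \<union> F \<and> y + 1 \<notin> E \<union> F"
        have "y < x \<Longrightarrow> y + 1 \<in> {e..x}" "x < y \<Longrightarrow> x + 1 \<in> {e..y}" using y e(2) by auto
        then have "\<not> y < x" "\<not> x < y" using y x'(1) e(3) by blast+
        then show "y = x" by simp
      qed
      ultimately show ?thesis by blast
    next
      case False
      have x': "x \<in> E \<union> F" "x + 1 \<notin> E \<union> F" "\<And>v. v \<in> S \<Longrightarrow> v \<le> x + 1 \<Longrightarrow> \<not> {v..x} \<subseteq> E \<union> F"
        using x by (auto simp: free_ends_def)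
      have "x \<notin> E" using False x'(1) by (force simp: subset_iff)
      then have "x \<in> F" using x'(1) by blast
      moreover have "\<not> {v..x} \<subseteq> F" if v: "v \<in> ends E" "v \<le> x + 1" for v
      proof
        assume sub: "{v..x} \<subseteq> F"
        consider "v \<in> E" | "v - 1 \<in> E" using v(1) by (auto simp: ends_def)
        then show False
        proof cases
          case 1
          then have "v \<noteq> x + 1" using x'(2) by auto
          then show False using False 1 v(2) sub by auto
        next
          case 2
          have "{v - 1..x} \<subseteq> insert (v - 1) {v..x}" by auto
          then have "{v - 1..x} \<subseteq> E \<union> F" using 2 sub by blast
          moreover have "v - 1 \<le> x" using v(2) by simp
          ultimately show False using False 2 by blast
        qed
      qed
      moreover have "\<not> {v..x} \<subseteq> F" if "v \<in> S" "v \<le> x + 1" for v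
        using x'(3)[OF that] by blast
      ultimately show ?thesis using x'(2) by (auto simp: free_ends_def)
    qed
  qed
  then have "card (free_ends (E \<union> F) S) \<le> card (?g ` free_ends E S \<union> free_ends F (S \<union> ends E))"
    using assms by (intro card_mono) auto
  also have "\<dots> \<le> card (free_ends E S) + card (free_ends F (S \<union> ends E))"
    using card_Un_le card_image_le[OF finite_free_ends[OF assms(1)]]
    by (meson add_mono le_refl le_trans)
  finally show ?thesis .
qed

text \<open>The component of E through this path already meets S in p or q, so no component avoiding
  S is lost.\<close>

lemma card_free_ends_insert_path:
  assumes "finite E" "{p..<q} \<subseteq> E" "p < q" "p \<in> S \<or> q \<in> S"
  shows "card (free_ends E S) \<le> card (free_ends E (S \<union> {p..q}))"
proof -
  have "\<not> {v..x} \<subseteq> E" if x: "x \<in> free_ends E S" and v: "v \<in> {p..q}" "v \<le> x + 1" for x v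
  proof
    assume sub: "{v..x} \<subseteq> E"
    have x': "x + 1 \<notin> E" "\<And>w. w \<in> S \<Longrightarrow> w \<le> x + 1 \<Longrightarrow> \<not> {w..x} \<subseteq> E"
      using x by (auto simp: free_ends_def)
    have "x + 1 < q \<Longrightarrow> x + 1 \<in> {p..<q}" using v by auto
    then have "x + 1 \<ge> q" using x'(1) assms(2) by force
    moreover have "{p..x} \<subseteq> {p..<q} \<union> {v..x}" "{q..x} \<subseteq> {v..x}" using v by auto
    then have "{p..x} \<subseteq> E" "{q..x} \<subseteq> E" using sub assms(2) by blast+
    ultimately show False using x'(2)[of p] x'(2)[of q] assms(3,4) by auto
  qed
  then have "free_ends E S \<subseteq> free_ends E (S \<union> {p..q})"
    by (auto simp: free_ends_def)
  then show ?thesis using assms(1) by (simp add: card_mono)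
qed

text \<open>A closed component is an entire component of E, so q - 1 is the only free end that can
  disappear.\<close>

lemma card_free_ends_insert_closed:
  assumes "finite E" "interval_comp E S p q" "p \<notin> S" "q \<notin> S"
  shows "card (free_ends E S) \<le> Suc (card (free_ends E (S \<union> {p..q})))"
proof -
  have pq: "p < q" "{p..<q} \<subseteq> E" "p - 1 \<notin> E" "q \<notin> E"
    using assms by (auto simp: interval_comp_def)
  have "\<not> {v..x} \<subseteq> E"
    if x: "x \<in> free_ends E S" "x \<noteq> q - 1" and v: "v \<in> {p..q}" "v \<le> x + 1" for x v
  proof
    assume sub: "{v..x} \<subseteq> E"
    have x': "x \<in> E" "x + 1 \<notin> E" using x(1) by (auto simp: free_ends_def)
    have "x < q" using sub v pq(4) by (auto simp: subset_iff not_less)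
    then have "x + 1 < q" using x(2) by auto
    then have "x + 1 < p" using pq(2) x'(2) by (auto simp: subset_iff not_less)
    then show False using v by auto
  qed
  then have "free_ends E S \<subseteq> insert (q - 1) (free_ends E (S \<union> {p..q}))"
    by (auto simp: free_ends_def)
  then have "card (free_ends E S) \<le> card (insert (q - 1) (free_ends E (S \<union> {p..q})))"
    using assms(1) by (simp add: card_mono)
  then show ?thesis using assms(1) by (simp add: card_insert_if split: if_splits)
qed

text \<open>A free end x with i \<le> x < j stops being free once {i..j} joins S: then x + 1 lies in
  S, and the interval {x + 1..x} in \<open>free_ends\<close> is empty.\<close>

lemma card_free_ends_split:
  assumes "finite E"
  shows "card (free_ends E S \<inter> {i..<j}) + card (free_ends E (S \<union> {i..j})) \<le> card (free_ends E S)"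
proof -
  have "free_ends E (S \<union> {i..j}) \<inter> {i..<j} = {}"
  proof -
    have False if "x \<in> free_ends E (S \<union> {i..j})" "i \<le> x" "x < j" for x
    proof -
      have "x + 1 \<in> S \<union> {i..j} \<Longrightarrow> \<not> {x + 1..x} \<subseteq> E" using that(1) unfolding free_ends_def by blast
      then show False using that by simp
    qed
    then show ?thesis by auto
  qed
  then have "card (free_ends E S \<inter> {i..<j}) + card (free_ends E (S \<union> {i..j}))
      = card (free_ends E S \<inter> {i..<j} \<union> free_ends E (S \<union> {i..j}))"
    using assms by (intro card_Un_disjoint[symmetric]) auto
  also have "\<dots> \<le> card (free_ends E S)"
    using assms free_ends_antimono[of S "S \<union> {i..j}" E] by (intro card_mono) auto
  finally show ?thesis .
qed

section \<open>Maximal intervals and closed components\<close>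

lemma maximal_interval:
  fixes M :: "int set"
  assumes "x \<in> M" "i \<le> x" "x < q"
  obtains a b where "i \<le> a" "a \<le> x" "x < b" "b \<le> q" "{a..<b} \<subseteq> M"
    "a = i \<or> a - 1 \<notin> M" "b = q \<or> b \<notin> M"
proof -
  have "x \<in> M \<longrightarrow> (\<exists>a. i \<le> a \<and> a \<le> x \<and> {a..x} \<subseteq> M \<and> (a = i \<or> a - 1 \<notin> M))"
    using assms(2)
  proof (induction x rule: int_ge_induct)
    case base
    show ?case by (auto intro!: exI[of _ i])
  next
    case (step x)
    show ?case
    proof (cases "x \<in> M")
      case True
      then obtain a where a: "i \<le> a" "a \<le> x" "{a..x} \<subseteq> M" "a = i \<or> a - 1 \<notin> M"
        using step.IH by blast
      have "{a..x + 1} \<subseteq> insert (x + 1) {a..x}" by auto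
      then show ?thesis using a by (intro impI exI[of _ a]) auto
    next
      case False
      then show ?thesis using step.hyps by (intro impI exI[of _ "x + 1"]) auto
    qed
  qed
  moreover have "x \<in> M \<longrightarrow> (\<exists>b. x < b \<and> b \<le> q \<and> {x..<b} \<subseteq> M \<and> (b = q \<or> b \<notin> M))"
    \<comment> \<open>The hypothesis becomes x \<le> q - 1, so that the downward induction starts at
      the last edge q - 1.\<close>
    using assms(3)[unfolded zless_imp_add1_zle, folded zle_diff1_eq]
  proof (induction x rule: int_le_induct)
    case base
    have "{q - 1..<q} = {q - 1}" by auto
    then show ?case by (intro impI exI[of _ q]) auto
  next
    case (step x)
    show ?case
    proof (cases "x \<in> M")
      case True
      then obtain b where b: "x < b" "b \<le> q" "{x..<b} \<subseteq> M" "b = q \<or> b \<notin> M"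
        using step.IH by blast
      have "{x - 1..<b} \<subseteq> insert (x - 1) {x..<b}" by auto
      then show ?thesis using b by (intro impI exI[of _ b]) auto
    next
      case False
      moreover have "{x - 1..<x} = {x - 1}" by auto
      ultimately show ?thesis using step.hyps by (intro impI exI[of _ x]) auto
    qed
  qed
  ultimately obtain a b where ab: "i \<le> a" "a \<le> x" "{a..x} \<subseteq> M" "a = i \<or> a - 1 \<notin> M"
    "x < b" "b \<le> q" "{x..<b} \<subseteq> M" "b = q \<or> b \<notin> M"
    using assms(1) by blast
  moreover have "{a..<b} \<subseteq> {a..x} \<union> {x..<b}" by auto
  ultimately show ?thesis using that[of a b] by blast
qed

lemma closed_free_end:
  assumes "interval_comp E S a b" "a \<notin> S" "b \<notin> S"
  shows "b - 1 \<in> free_ends E S"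
proof -
  have ab: "a < b" "{a..<b} \<subseteq> E" "S \<inter> {a..b} = {}" "a - 1 \<notin> E" "b \<notin> E"
    using assms by (auto simp: interval_comp_def)
  have "\<not> {v..b - 1} \<subseteq> E" if "v \<in> S" "v \<le> b" for v
  proof
    assume *: "{v..b - 1} \<subseteq> E"
    have "v < a" using that ab(3) by force
    then have "a - 1 \<in> {v..b - 1}" using ab(1) by auto
    then show False using * ab(4) by blast
  qed
  then show ?thesis using ab by (auto simp: free_ends_def)
qed

section \<open>The constants\<close>

definition \<gamma> :: real where "\<gamma> = sqrt 5 + 2"

definition \<beta> :: real where "\<beta> = sqrt 5 + 5"

lemma \<beta>_eq: "\<beta> = \<gamma> + 3"
  by (simp add: \<gamma>_def \<beta>_def)

text \<open>The minimal polynomial of \<gamma>; it makes quadratic expressions in \<gamma> linear,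
  which \<open>\<gamma>_bounds\<close> can then compare.\<close>

lemma \<gamma>_square: "\<gamma> * \<gamma> = 4 * \<gamma> + 1"
  by (simp add: \<gamma>_def algebra_simps)

lemma \<gamma>_bounds: "4236 / 1000 < \<gamma>" "\<gamma> < 4237 / 1000"
proof -
  have "2236 / 1000 < sqrt 5" by (rule real_less_rsqrt) (simp add: power2_eq_square)
  then show "4236 / 1000 < \<gamma>" by (simp add: \<gamma>_def)
  have "sqrt 5 < 2237 / 1000" by (rule real_less_lsqrt) (simp_all add: power2_eq_square)
  then show "\<gamma> < 4237 / 1000" by (simp add: \<gamma>_def)
qed

text \<open>Converts a number of pieces into the gain \<open>\<beta> ^ m\<close>: a step from m to m
  + 1 at most doubles the left-hand side.\<close>

lemma linear_le_power: "1 \<le> m \<Longrightarrow> real m * \<beta> \<le> \<beta> ^ m"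
proof (induction m rule: dec_induct)
  case (step m)
  have "real (Suc m) * \<beta> \<le> 2 * (real m * \<beta>)"
    using mult_right_mono[of 1 "real m" \<beta>] step.hyps \<gamma>_bounds by (simp add: \<beta>_eq algebra_simps)
  also have "\<dots> \<le> \<beta> * \<beta> ^ m"
    using step.IH \<gamma>_bounds by (rule_tac mult_mono) (auto simp: \<beta>_eq)
  finally show ?case by simp
qed simp

lemma linear_le_power2: "2 \<le> m \<Longrightarrow> real m * (\<beta> * \<beta>) \<le> 2 * \<beta> ^ m"
proof (induction m rule: dec_induct)
  case base
  then show ?case by (simp add: power2_eq_square)
next
  case (step m)
  have "real (Suc m) * (\<beta> * \<beta>) \<le> 2 * (real m * (\<beta> * \<beta>))"
    using mult_right_mono[of 1 "real m" "\<beta> * \<beta>"] step.hyps by (simp add: algebra_simps)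
  also have "\<dots> \<le> \<beta> * (2 * \<beta> ^ m)"
    using step.IH \<gamma>_bounds by (rule_tac mult_mono) (auto simp: \<beta>_eq)
  finally show ?case by simp
qed

section \<open>Runs and gaps of one component\<close>

text \<open>The values are c \<epsilon> \<delta>, c \<delta> and 1, chosen so that one right-hand
  side serves all three kinds of component.\<close>

definition weight :: "int set \<Rightarrow> int \<Rightarrow> int \<Rightarrow> real" where
  "weight S i j = (if i \<in> S \<and> j \<in> S then \<gamma> / 2 else if i \<in> S \<or> j \<in> S then \<gamma> else 1)"

text \<open>A component of \<open>E \<union> F\<close> is cut into runs of \<open>E\<close> and gaps between them, which are components
  of \<open>F\<close> relative to \<open>S\<close> and the vertices of \<open>E\<close>; \<open>t\<close> is the common bound supplied by induction.\<close>

locale split_comp =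
  fixes E F S :: "int set" and i q :: int and t :: real
  assumes fin: "finite E" "finite F"
    and K: "interval_comp (E \<union> F) S i q"
    and t_nonneg: "0 \<le> t"
    and run: "\<And>a b. interval_comp E S a b \<Longrightarrow> weight S a b * real_of_int (b - a) \<le> t"
    and gap: "\<And>a b. interval_comp F (S \<union> ends E) a b \<Longrightarrow>
      weight (S \<union> ends E) a b * real_of_int (b - a) \<le> t"
begin

text \<open>Closed runs are recorded by their last edges, so that their number m is
  \<open>card R\<close> and at the same time a part of Delta.\<close>

definition R :: "int set" where
  "R = free_ends E S \<inter> {i..<q}"

lemma finite_R [simp]: "finite R"
  using fin by (simp add: R_def)

lemma K_simps: "i < q" "\<And>x. i \<le> x \<Longrightarrow> x < q \<Longrightarrow> x \<in> E \<or> x \<in> F"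
  "\<And>x. x \<in> S \<Longrightarrow> i \<le> x \<Longrightarrow> x \<le> q \<Longrightarrow> x = i \<or> x = q"
  "i \<notin> S \<Longrightarrow> i - 1 \<notin> E" "i \<notin> S \<Longrightarrow> i - 1 \<notin> F" "q \<notin> S \<Longrightarrow> q \<notin> E" "q \<notin> S \<Longrightarrow> q \<notin> F"
  using K unfolding interval_comp_def by auto

text \<open>Cutting at i creates no false end: either i is in S, or E has no edge just before i. The
  same holds at q.\<close>

lemma obtain_run:
  assumes "x \<in> E" "i \<le> x" "x < q"
  obtains a b where "i \<le> a" "a \<le> x" "x < b" "b \<le> q" "interval_comp E S a b"
    "a = i \<or> a - 1 \<notin> E" "b = q \<or> b \<notin> E" "{a..<b} \<subseteq> E"
proof -
  obtain a b where ab: "i \<le> a" "a \<le> x" "x < b" "b \<le> q" "{a..<b} \<subseteq> E"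
    "a = i \<or> a - 1 \<notin> E" "b = q \<or> b \<notin> E"
    by (rule maximal_interval[OF assms])
  have "S \<inter> {a..b} \<subseteq> {a, b}"
  proof
    fix v assume "v \<in> S \<inter> {a..b}"
    then show "v \<in> {a, b}" using K_simps(3)[of v] ab by auto
  qed
  then have "interval_comp E S a b"
    using ab K_simps(4,6) by (auto simp: interval_comp_def)
  then show ?thesis using that ab by blast
qed

lemma obtain_gap:
  assumes "x \<notin> E" "i \<le> x" "x < q"
  obtains a b where "i \<le> a" "a \<le> x" "x < b" "b \<le> q" "interval_comp F (S \<union> ends E) a b"
    "a = i \<or> a - 1 \<in> E" "b = q \<or> b \<in> E" "{a..<b} \<inter> E = {}"
proof -
  obtain a b where ab: "i \<le> a" "a \<le> x" "x < b" "b \<le> q" "{a..<b} \<subseteq> - E"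
    "a = i \<or> a - 1 \<notin> - E" "b = q \<or> b \<notin> - E"
    by (rule maximal_interval[of x "- E"]) (use assms in auto)
  have notE: "y \<notin> E" if "a \<le> y" "y < b" for y
    using ab(5) that by (meson ComplD atLeastLessThan_iff subsetD)
  \<comment> \<open>A vertex of E has an edge of E on its left or on its right; strictly inside a
    gap neither exists.\<close>
  have "v = a \<or> v = b" if v: "v \<in> S \<union> ends E" "a \<le> v" "v \<le> b" for v
  proof (cases "v \<in> S")
    case True
    then show ?thesis using K_simps(3)[of v] v ab by linarith
  next
    case False
    then have "v \<in> E \<or> v - 1 \<in> E" using v by (auto simp: ends_def)
    then have "\<not> (a \<le> v \<and> v < b) \<or> \<not> (a \<le> v - 1 \<and> v - 1 < b)" using notE by blast
    then show ?thesis using v by linarith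
  qed
  then have S: "(S \<union> ends E) \<inter> {a..b} \<subseteq> {a, b}" by (metis Int_iff atLeastAtMost_iff insertI1 insertI2 singletonI subsetI)
  have l: "a - 1 \<notin> F" if "a \<notin> S \<union> ends E"
  proof -
    have "a - 1 \<notin> E" using that by (auto simp: ends_def intro: image_eqI[of _ _ "a - 1"])
    then show ?thesis using ab(6) K_simps(5) that by auto
  qed
  have r: "b \<notin> F" if "b \<notin> S \<union> ends E"
    using ab(7) K_simps(7) that by (auto simp: ends_def)
  have F: "{a..<b} \<subseteq> F"
  proof
    fix y assume "y \<in> {a..<b}"
    then show "y \<in> F" using notE[of y] K_simps(2)[of y] ab by simp
  qed
  have "a < b" using ab by linarith
  then have "interval_comp F (S \<union> ends E) a b"
    unfolding interval_comp_def using S l r F by blast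
  moreover have "a = i \<or> a - 1 \<in> E" "b = q \<or> b \<in> E" "{a..<b} \<inter> E = {}" using ab(5-7) by blast+
  ultimately show ?thesis using that ab(1-4) by blast
qed

lemma run_closed:
  assumes "interval_comp E S a b" "a \<notin> S" "b \<notin> S"
  shows "real_of_int (b - a) \<le> t"
  using run[OF assms(1)] assms by (simp add: weight_def)

lemma run_half:
  assumes "interval_comp E S a b" "(a \<in> S) \<noteq> (b \<in> S)"
  shows "real_of_int (b - a) \<le> t / \<gamma>"
proof -
  have "weight S a b = \<gamma>" using assms(2) by (auto simp: weight_def)
  then show ?thesis using run[OF assms(1)] \<gamma>_bounds by (simp add: pos_le_divide_eq mult.commute)
qed

lemma run_open:
  assumes "interval_comp E S a b" "a \<in> S" "b \<in> S"
  shows "real_of_int (b - a) \<le> 2 * t / \<gamma>"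
  using run[OF assms(1)] assms \<gamma>_bounds by (simp add: weight_def field_simps)

lemma gap_half:
  assumes "interval_comp F (S \<union> ends E) a b" "(a \<in> S \<union> ends E) \<noteq> (b \<in> S \<union> ends E)"
  shows "real_of_int (b - a) \<le> t / \<gamma>"
proof -
  have "weight (S \<union> ends E) a b = \<gamma>" using assms(2) by (auto simp: weight_def)
  then show ?thesis using gap[OF assms(1)] \<gamma>_bounds by (simp add: pos_le_divide_eq mult.commute)
qed

lemma gap_open:
  assumes "interval_comp F (S \<union> ends E) a b" "a \<in> S \<union> ends E \<or> b \<in> S \<union> ends E"
  shows "real_of_int (b - a) \<le> 2 * t / \<gamma>"
proof (cases "a \<in> S \<union> ends E \<and> b \<in> S \<union> ends E")
  case True
  then show ?thesis using gap[OF assms(1)] \<gamma>_bounds by (simp add: weight_def field_simps)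
next
  case False
  then have "real_of_int (b - a) \<le> t / \<gamma>" using gap_half[OF assms(1)] assms(2) by blast
  also have "\<dots> \<le> 2 * t / \<gamma>" using t_nonneg \<gamma>_bounds by (simp add: divide_right_mono)
  finally show ?thesis .
qed

text \<open>S meets the component in i and q at most, so only a first or a last run can fail to be
  closed.\<close>

lemma nonclosed_run:
  assumes "interval_comp E S a b" "i \<le> a" "b \<le> q" "a \<in> S \<or> b \<in> S"
  shows "a = i \<and> i \<in> S \<or> b = q \<and> q \<in> S"
proof -
  have "a < b" using assms(1) by (simp add: interval_comp_def)
  then show ?thesis using assms K_simps(3)[of a] K_simps(3)[of b] by auto
qed

lemma whole_run:
  assumes "interval_comp E S i q" "i \<in> S \<or> q \<in> S"
  shows "R = {}"
proof -
  have False if "r \<in> R" for r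
  proof -
    have r: "i \<le> r" "r < q" "r + 1 \<notin> E" "\<And>v. v \<in> S \<Longrightarrow> v \<le> r + 1 \<Longrightarrow> \<not> {v..r} \<subseteq> E"
      using that by (auto simp: R_def free_ends_def)
    have sub: "{i..<q} \<subseteq> E" using assms(1) by (simp add: interval_comp_def)
    have "r + 1 \<noteq> q \<Longrightarrow> r + 1 \<in> {i..<q}" using r(1,2) by auto
    then have "r + 1 = q" using r(3) sub by blast
    then have "\<not> {q..r} \<subseteq> E" if "q \<in> S" using r(4)[of q] that by simp
    moreover have "\<not> {i..r} \<subseteq> E" if "i \<in> S" using r(1) r(4)[of i] that by simp
    moreover have "{i..r} \<subseteq> E" "{q..r} \<subseteq> E" using sub r(1,2) by auto
    ultimately show False using assms(2) by blast
  qed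
  then show ?thesis by blast
qed

section \<open>Length estimates from a covering by pieces\<close>

text \<open>A charging scheme for the edge x. In a closed run it is charged to the last edge r of
  the run, in a gap to the closed run just before the gap. The rest lies near the ends: a gap at i,
  or a half-open run at i and the gap after it (t / \<gamma> + 2 t / \<gamma>), or a half-open run
  at q. The side conditions exclude one of the last two cases when the corresponding end is
  free.\<close>

lemma cover:
  assumes x: "i \<le> x" "x < q" and m: "R \<noteq> {}"
  obtains r where "r \<in> R" "real_of_int (r + 1 - x) \<le> t" "x \<le> r"
  | r where "r \<in> R" "real_of_int (x - r) \<le> 2 * t / \<gamma>" "r < x"
  | "real_of_int (x + 1 - i) \<le> 3 * t / \<gamma>" "i \<in> S \<or> i \<notin> E"
  | "real_of_int (q - x) \<le> t / \<gamma>" "q \<in> S"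
proof -
  have mono: "t / \<gamma> \<le> 3 * t / \<gamma>" "2 * t / \<gamma> \<le> 3 * t / \<gamma>"
    using t_nonneg \<gamma>_bounds by (simp_all add: divide_right_mono)
  show ?thesis
  proof (cases "x \<in> E")
    case True
    then obtain a b where ab: "i \<le> a" "a \<le> x" "x < b" "b \<le> q" "interval_comp E S a b"
      using obtain_run x by metis
    consider "a \<notin> S" "b \<notin> S" | "a = i" "i \<in> S" "b \<notin> S" | "b = q" "q \<in> S" "a \<notin> S"
      | "a = i" "b = q" "i \<in> S" "q \<in> S"
      using nonclosed_run[OF ab(5)] ab K_simps(3)[of a] K_simps(3)[of b] by fastforce
    then show ?thesis
    proof cases
      case 1
      then have "b - 1 \<in> R" using closed_free_end[OF ab(5)] ab by (auto simp: R_def)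
      then show ?thesis using that(1)[of "b - 1"] run_closed[OF ab(5)] 1 ab by simp
    next
      case 2
      then show ?thesis using that(3) run_half[OF ab(5)] ab mono by simp
    next
      case 3
      then show ?thesis using that(4) run_half[OF ab(5)] ab by simp
    next
      case 4
      then show ?thesis using whole_run ab m by blast
    qed
  next
    case False
    then obtain a b where ab: "i \<le> a" "a \<le> x" "x < b" "b \<le> q"
      "interval_comp F (S \<union> ends E) a b" "a = i \<or> a - 1 \<in> E" "b = q \<or> b \<in> E" "{a..<b} \<inter> E = {}"
      using obtain_gap x by metis
    \<comment> \<open>A gap filling the whole component would leave no edge for \<open>R\<close>.
      Hence the gap borders on an edge of E and is not closed.\<close>
    have "a \<noteq> i \<or> b \<noteq> q" using m ab(8) by (auto simp: R_def free_ends_def)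
    then have "a \<in> S \<union> ends E \<or> b \<in> S \<union> ends E"
      using ab(6,7) by (auto simp: ends_def intro: image_eqI[of _ _ "a - 1"])
    note len = gap_open[OF ab(5) this]
    show ?thesis
    proof (cases "a = i")
      case True
      then have "real_of_int (x + 1 - i) \<le> real_of_int (b - a)" "i \<in> {a..<b}" using ab by auto
      then show ?thesis using that(3) len mono ab(8) by (meson disjoint_iff order_trans)
    next
      case False
      have "a \<in> {a..<b}" using ab by auto
      then have "a \<notin> E" using ab(8) by blast
      then have a1: "a - 1 \<in> E" "i \<le> a - 1" "a - 1 < q" "a \<notin> E" using False ab by auto
      then obtain a' b' where ab': "i \<le> a'" "a' \<le> a - 1" "a - 1 < b'" "b' \<le> q"
        "interval_comp E S a' b'" "{a'..<b'} \<subseteq> E"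
        using obtain_run by metis
      have "a < b' \<Longrightarrow> a \<in> {a'..<b'}" using ab' by auto
      then have "\<not> a < b'" using ab'(6) a1(4) by blast
      then have b': "b' = a" using ab'(3) by simp
      have "a \<notin> S" using K_simps(3)[of a] ab False by force
      show ?thesis
      proof (cases "a' \<in> S")
        case True
        then have "a' = i" "i \<in> S" using K_simps(3)[of a'] ab' by auto
        moreover have "real_of_int (a - a') \<le> t / \<gamma>"
          using run_half[OF ab'(5)] b' True \<open>a \<notin> S\<close> by simp
        moreover have "real_of_int (x + 1 - i) \<le> real_of_int (a - i) + real_of_int (b - a)"
          using ab by simp
        moreover have "3 * t / \<gamma> = t / \<gamma> + 2 * t / \<gamma>"
          by (simp flip: add_divide_distrib)
        ultimately have "real_of_int (x + 1 - i) \<le> 3 * t / \<gamma>" using len by linarith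
        then show ?thesis using that(3) \<open>i \<in> S\<close> by blast
      next
        case False
        then have "a - 1 \<in> R" using closed_free_end[OF ab'(5)] b' \<open>a \<notin> S\<close> a1 by (auto simp: R_def)
        then show ?thesis using that(2)[of "a - 1"] len ab by simp
      qed
    qed
  qed
qed

lemma interval_length_le:
  assumes "{i..<q} \<subseteq> (\<Union>r\<in>R. {f r..<g r}) \<union> {a..<b} \<union> {a'..<b'}"
    and "\<And>r. r \<in> R \<Longrightarrow> real_of_int (g r - f r) \<le> l"
    and "real_of_int (b - a) \<le> la" "real_of_int (b' - a') \<le> lb" "0 \<le> l" "0 \<le> la" "0 \<le> lb"
  shows "real_of_int (q - i) \<le> real (card R) * l + la + lb"
proof -
  have card_le: "real (card {a..<b}) \<le> y" if "real_of_int (b - a) \<le> y" "0 \<le> y" for a b :: int and y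
    using that by (cases "a \<le> b") auto
  have "card {i..<q} \<le> card ((\<Union>r\<in>R. {f r..<g r}) \<union> {a..<b} \<union> {a'..<b'})"
    using assms(1) by (intro card_mono) auto
  also have "\<dots> \<le> card (\<Union>r\<in>R. {f r..<g r}) + card {a..<b} + card {a'..<b'}"
    by (meson add_mono card_Un_le le_refl le_trans)
  also have "\<dots> \<le> (\<Sum>r\<in>R. card {f r..<g r}) + card {a..<b} + card {a'..<b'}"
    by (intro add_mono card_UN_le) auto
  finally have "real (card {i..<q}) \<le> (\<Sum>r\<in>R. real (card {f r..<g r})) + real (card {a..<b}) + real (card {a'..<b'})"
    by (simp flip: of_nat_sum of_nat_add del: card_atLeastLessThan_int)
  also have "\<dots> \<le> (\<Sum>r\<in>R. l) + la + lb"
    using assms by (intro add_mono sum_mono card_le) auto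
  finally show ?thesis using K_simps(1) by simp
qed

text \<open>Each closed run accounts for t and for 2 t / \<gamma> in the gap after it; the left end
  adds 3 t / \<gamma>, the right end t / \<gamma>.\<close>

lemma length_le_card:
  assumes "R \<noteq> {}"
  shows "real_of_int (q - i) \<le> (real (card R) * (1 + 2 / \<gamma>) + 4 / \<gamma>) * t"
proof -
  \<comment> \<open>The distances in \<open>cover\<close> are integers, so rounding the real bounds
    down loses nothing.\<close>
  let ?f = "\<lambda>r. r + 1 - \<lfloor>t\<rfloor>" and ?g = "\<lambda>r. r + 1 + \<lfloor>2 * t / \<gamma>\<rfloor>"
  have nn: "0 \<le> \<lfloor>2 * t / \<gamma>\<rfloor>" "0 \<le> \<lfloor>t\<rfloor>" "0 \<le> t / \<gamma>" using t_nonneg \<gamma>_bounds by auto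
  have "{i..<q} \<subseteq> (\<Union>r\<in>R. {?f r..<?g r}) \<union> {i..<i + \<lfloor>3 * t / \<gamma>\<rfloor>} \<union> {q - \<lfloor>t / \<gamma>\<rfloor>..<q}"
  proof
    fix x assume "x \<in> {i..<q}"
    then have x: "i \<le> x" "x < q" by auto
    show "x \<in> (\<Union>r\<in>R. {?f r..<?g r}) \<union> {i..<i + \<lfloor>3 * t / \<gamma>\<rfloor>} \<union> {q - \<lfloor>t / \<gamma>\<rfloor>..<q}"
      using x assms
    proof (cases rule: cover)
      case (1 r)
      then have "r + 1 - x \<le> \<lfloor>t\<rfloor>" by (simp add: le_floor_iff)
      then have "x \<in> {?f r..<?g r}" unfolding atLeastLessThan_iff using 1 nn by linarith
      then show ?thesis using 1 by blast
    next
      case (2 r)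
      then have "x - r \<le> \<lfloor>2 * t / \<gamma>\<rfloor>" by (simp add: le_floor_iff)
      then have "x \<in> {?f r..<?g r}" unfolding atLeastLessThan_iff using 2 nn by linarith
      then show ?thesis using 2 by blast
    next
      case 3
      then have "x + 1 - i \<le> \<lfloor>3 * t / \<gamma>\<rfloor>" by (simp add: le_floor_iff)
      then show ?thesis using x by force
    next
      case 4
      then have "q - x \<le> \<lfloor>t / \<gamma>\<rfloor>" by (simp add: le_floor_iff)
      then show ?thesis using x by force
    qed
  qed
  note len = interval_length_le[OF this, where l = "t + 2 * t / \<gamma>" and la = "3 * t / \<gamma>" and lb = "t / \<gamma>"]
  have "real_of_int (q - i) \<le> real (card R) * (t + 2 * t / \<gamma>) + 3 * t / \<gamma> + t / \<gamma>"
    using len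
      t_nonneg \<gamma>_bounds of_int_floor_le[of t] of_int_floor_le[of "2 * t / \<gamma>"] by simp
  then show ?thesis by (simp add: field_simps)
qed

text \<open>The run ending at q either reaches back to i and is half-open, or is the only closed
  run. In the latter case no gap follows it, and t + 3 t / \<gamma> = \<beta> t / \<gamma>, with no
  slack.\<close>

lemma length_le_free_right:
  assumes "i \<in> S" "q \<notin> S" "q - 1 \<in> E" "card R \<le> 1"
  shows "\<gamma> * real_of_int (q - i) \<le> \<beta> ^ card R * t"
proof -
  obtain a where a: "i \<le> a" "a \<le> q - 1" "interval_comp E S a q"
    using obtain_run[OF assms(3)] K_simps(1)
    by (smt (verit))
  show ?thesis
  proof (cases "a \<in> S")
    case True
    then have "a = i" using K_simps(3)[of a] a by auto
    then have "R = {}" "\<gamma> * real_of_int (q - i) \<le> t"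
      using whole_run run_half[of i q] a assms \<gamma>_bounds by (auto simp: field_simps)
    then show ?thesis by simp
  next
    case False
    then have "q - 1 \<in> R" using closed_free_end[OF a(3)] assms(2) a by (auto simp: R_def)
    moreover from this have "card R = 1" using assms(4) card_gt_0_iff[of R] by fastforce
    ultimately have R: "R = {q - 1}" by (auto simp: card_1_singleton_iff)
    have "{i..<q} \<subseteq> (\<Union>r\<in>R. {q - \<lfloor>t\<rfloor>..<q}) \<union> {i..<i + \<lfloor>3 * t / \<gamma>\<rfloor>} \<union> {q..<q}"
    proof
      fix x assume "x \<in> {i..<q}"
      then have x: "i \<le> x" "x < q" by auto
      have "R \<noteq> {}" using R by simp
      with x show "x \<in> (\<Union>r\<in>R. {q - \<lfloor>t\<rfloor>..<q}) \<union> {i..<i + \<lfloor>3 * t / \<gamma>\<rfloor>} \<union> {q..<q}"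
      proof (cases rule: cover)
        case (1 r)
        then have "q - x \<le> \<lfloor>t\<rfloor>" using R by (simp add: le_floor_iff)
        then show ?thesis using 1 x by force
      next
        case (2 r)
        then show ?thesis using R x by simp
      next
        case 3
        then have "x + 1 - i \<le> \<lfloor>3 * t / \<gamma>\<rfloor>" by (simp add: le_floor_iff)
        then show ?thesis using x by force
      next
        case 4
        then show ?thesis using assms by simp
      qed
    qed
    note len = interval_length_le[OF this, where l = t and la = "3 * t / \<gamma>" and lb = 0]
    have "real_of_int (q - i) \<le> real (card R) * t + 3 * t / \<gamma> + 0"
      using len
        t_nonneg \<gamma>_bounds by simp
    then show ?thesis using \<open>card R = 1\<close> \<gamma>_bounds by (simp add: \<beta>_eq field_simps)
  qed
qed

text \<open>Not a mirror image of the preceding proof, as gaps are charged to the run on their left: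
  the closed run at i takes t, the gap after it 2 t / \<gamma>, the run at q t / \<gamma>. The sum
  is the same.\<close>

lemma length_le_free_left:
  assumes "i \<notin> S" "q \<in> S" "i \<in> E" "card R \<le> 1"
  shows "\<gamma> * real_of_int (q - i) \<le> \<beta> ^ card R * t"
proof -
  obtain b where b: "i < b" "b \<le> q" "interval_comp E S i b"
    using obtain_run[OF assms(3)] K_simps(1)
    by (smt (verit))
  show ?thesis
  proof (cases "b \<in> S")
    case True
    then have "b = q" using K_simps(3)[of b] b by auto
    then have "R = {}" "\<gamma> * real_of_int (q - i) \<le> t"
      using whole_run run_half[of i q] b assms \<gamma>_bounds by (auto simp: field_simps)
    then show ?thesis by simp
  next
    case False
    then have "b - 1 \<in> R" using closed_free_end[OF b(3)] assms(1) b by (auto simp: R_def)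
    moreover from this have "card R = 1" using assms(4) card_gt_0_iff[of R] by fastforce
    ultimately have R: "R = {b - 1}" by (auto simp: card_1_singleton_iff)
    have nn: "0 \<le> \<lfloor>2 * t / \<gamma>\<rfloor>" "0 \<le> \<lfloor>t\<rfloor>" using t_nonneg \<gamma>_bounds by auto
    have "{i..<q} \<subseteq> (\<Union>r\<in>R. {b - \<lfloor>t\<rfloor>..<b + \<lfloor>2 * t / \<gamma>\<rfloor>}) \<union> {q - \<lfloor>t / \<gamma>\<rfloor>..<q} \<union> {q..<q}"
    proof
      fix x assume "x \<in> {i..<q}"
      then have x: "i \<le> x" "x < q" by auto
      have "R \<noteq> {}" using R by simp
      with x show "x \<in> (\<Union>r\<in>R. {b - \<lfloor>t\<rfloor>..<b + \<lfloor>2 * t / \<gamma>\<rfloor>}) \<union> {q - \<lfloor>t / \<gamma>\<rfloor>..<q} \<union> {q..<q}"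
      proof (cases rule: cover)
        case (1 r)
        then have r: "r = b - 1" using R by simp
        with 1 have "b - x \<le> \<lfloor>t\<rfloor>" using R by (simp add: le_floor_iff)
        then have "x \<in> {b - \<lfloor>t\<rfloor>..<b + \<lfloor>2 * t / \<gamma>\<rfloor>}"
          unfolding atLeastLessThan_iff using 1 r nn by linarith
        then show ?thesis using 1 by blast
      next
        case (2 r)
        then have r: "r = b - 1" using R by simp
        with 2 have "x - (b - 1) \<le> \<lfloor>2 * t / \<gamma>\<rfloor>" using R by (simp add: le_floor_iff)
        then have "x \<in> {b - \<lfloor>t\<rfloor>..<b + \<lfloor>2 * t / \<gamma>\<rfloor>}"
          unfolding atLeastLessThan_iff using 2 r nn by linarith
        then show ?thesis using 2 by blast
      next
        case 3
        then show ?thesis using assms by simp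
      next
        case 4
        then have "q - x \<le> \<lfloor>t / \<gamma>\<rfloor>" by (simp add: le_floor_iff)
        then show ?thesis using x by force
      qed
    qed
    note len = interval_length_le[OF this, where l = "t + 2 * t / \<gamma>" and la = "t / \<gamma>" and lb = 0]
    have "real_of_int (q - i) \<le> real (card R) * (t + 2 * t / \<gamma>) + t / \<gamma> + 0"
      using len
        t_nonneg \<gamma>_bounds of_int_floor_le[of t] of_int_floor_le[of "2 * t / \<gamma>"] by simp
    then show ?thesis using \<open>card R = 1\<close> \<gamma>_bounds by (simp add: \<beta>_eq field_simps)
  qed
qed

text \<open>The factor 61/100 of the second bound lies just below 1 / phi = 0.618...; hence a closed
  component that fills at least 1 / phi of a length exceeding its budget cannot have two closed
  runs.\<close>

lemma length_le_many:
  assumes "2 \<le> card R"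
  shows "\<gamma> * real_of_int (q - i) \<le> \<beta> ^ card R * t"
    and "100 * \<beta> * real_of_int (q - i) \<le> 61 * \<beta> ^ card R * t"
proof -
  let ?m = "real (card R)"
  have "R \<noteq> {}" using assms by auto
  then have *: "real_of_int (q - i) \<le> (?m * (1 + 2 / \<gamma>) + 4 / \<gamma>) * t"
    by (rule length_le_card)
  have "\<gamma> * (?m * (1 + 2 / \<gamma>) + 4 / \<gamma>) = ?m * (\<gamma> + 2) + 4"
    using \<gamma>_bounds by (simp add: field_simps)
  also have "\<dots> \<le> ?m * (\<gamma> + 4)" using assms by (simp add: algebra_simps)
  finally have c: "\<gamma> * (?m * (1 + 2 / \<gamma>) + 4 / \<gamma>) \<le> ?m * (\<gamma> + 4)" .
  have bb: "\<beta> * \<beta> = 10 * \<gamma> + 10" using \<gamma>_square by (simp add: \<beta>_eq algebra_simps)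
  have p: "?m * (10 * \<gamma> + 10) \<le> 2 * \<beta> ^ card R" using linear_le_power2[OF assms] bb by simp
  have "2 * (?m * (\<gamma> + 4)) = ?m * (2 * (\<gamma> + 4))" by simp
  also have "\<dots> \<le> ?m * (10 * \<gamma> + 10)"
    using \<gamma>_bounds by (intro mult_left_mono) auto
  finally have c1: "?m * (\<gamma> + 4) \<le> \<beta> ^ card R" using p by linarith
  have "\<gamma> * real_of_int (q - i) \<le> (\<gamma> * (?m * (1 + 2 / \<gamma>) + 4 / \<gamma>)) * t"
    using mult_left_mono[OF *, of \<gamma>] \<gamma>_bounds by (simp add: mult.assoc)
  also have le: "\<dots> \<le> (?m * (\<gamma> + 4)) * t" using c t_nonneg by (rule mult_right_mono)
  finally have l: "\<gamma> * real_of_int (q - i) \<le> (?m * (\<gamma> + 4)) * t" .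
  also have "\<dots> \<le> \<beta> ^ card R * t" using c1 t_nonneg by (rule mult_right_mono)
  finally show "\<gamma> * real_of_int (q - i) \<le> \<beta> ^ card R * t" .
  have "200 * \<beta> * (\<gamma> + 4) \<le> 61 * (10 * \<gamma> + 10) * \<gamma>"
    using \<gamma>_square \<gamma>_bounds by (simp add: \<beta>_eq algebra_simps)
  then have "?m * (200 * \<beta> * (\<gamma> + 4)) \<le> ?m * (61 * (10 * \<gamma> + 10) * \<gamma>)"
    by (intro mult_left_mono) auto
  also have "\<dots> = 61 * \<gamma> * (?m * (10 * \<gamma> + 10))" by (simp add: algebra_simps)
  also have "\<dots> \<le> 61 * \<gamma> * (2 * \<beta> ^ card R)" using p \<gamma>_bounds by (intro mult_left_mono) auto
  finally have "2 * (?m * (100 * \<beta> * (\<gamma> + 4))) \<le> 2 * (61 * \<gamma> * \<beta> ^ card R)"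
    by (simp add: algebra_simps)
  then have "?m * (100 * \<beta> * (\<gamma> + 4)) \<le> 61 * \<gamma> * \<beta> ^ card R"
    by (simp only: mult_le_cancel_left_pos zero_less_numeral)
  then have "?m * (100 * \<beta> * (\<gamma> + 4)) * t \<le> 61 * \<gamma> * \<beta> ^ card R * t"
    using t_nonneg by (rule mult_right_mono)
  moreover have "100 * \<beta> * (\<gamma> * real_of_int (q - i)) \<le> 100 * \<beta> * ((?m * (\<gamma> + 4)) * t)"
    using l \<gamma>_bounds by (intro mult_left_mono) (auto simp: \<beta>_eq)
  ultimately have "\<gamma> * (100 * \<beta> * real_of_int (q - i)) \<le> \<gamma> * (61 * \<beta> ^ card R * t)"
    by (simp add: algebra_simps)
  then show "100 * \<beta> * real_of_int (q - i) \<le> 61 * \<beta> ^ card R * t"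
    using \<gamma>_bounds by simp
qed

text \<open>E has to contain the edge at the free end. Otherwise another half-open gap of length t /
  \<gamma> could occur there, for which \<beta> does not pay.\<close>

lemma length_le_half:
  assumes "i \<in> S \<and> q \<notin> S \<and> q - 1 \<in> E \<or> i \<notin> S \<and> q \<in> S \<and> i \<in> E"
  shows "\<gamma> * real_of_int (q - i) \<le> \<beta> ^ card R * t"
proof (cases "2 \<le> card R")
  case True
  then show ?thesis by (rule length_le_many(1))
next
  case False
  then have "card R \<le> 1" by simp
  then show ?thesis using assms length_le_free_left length_le_free_right by blast
qed

lemma length_le_open:
  assumes "R \<noteq> {}"
  shows "\<gamma> / 2 * real_of_int (q - i) \<le> \<beta> ^ card R * t"
proof -
  let ?m = "real (card R)"
  have m: "1 \<le> card R" using assms by (simp add: Suc_le_eq card_gt_0_iff)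
  have "\<gamma> / 2 * (?m * (1 + 2 / \<gamma>) + 4 / \<gamma>) = (?m * (\<gamma> + 2) + 4) / 2"
    using \<gamma>_bounds by (simp add: field_simps)
  also have "\<dots> \<le> ?m * (\<gamma> + 6) / 2" using m by (simp add: algebra_simps)
  also have "\<dots> = ?m * ((\<gamma> + 6) / 2)" by simp
  also have "\<dots> \<le> ?m * \<beta>" using \<gamma>_bounds by (intro mult_left_mono) (auto simp: \<beta>_eq)
  also have "\<dots> \<le> \<beta> ^ card R" using linear_le_power[OF m] .
  finally have "\<gamma> / 2 * (?m * (1 + 2 / \<gamma>) + 4 / \<gamma>) * t \<le> \<beta> ^ card R * t"
    using t_nonneg by (rule mult_right_mono)
  moreover have "\<gamma> / 2 * real_of_int (q - i) \<le> \<gamma> / 2 * ((?m * (1 + 2 / \<gamma>) + 4 / \<gamma>) * t)"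
    using length_le_card[OF assms] \<gamma>_bounds by (intro mult_left_mono) auto
  then have "\<gamma> / 2 * real_of_int (q - i) \<le> \<gamma> / 2 * (?m * (1 + 2 / \<gamma>) + 4 / \<gamma>) * t"
    by (simp only: mult.assoc)
  ultimately show ?thesis by linarith
qed

text \<open>Without closed runs every run of E starts at i, ends at q or fills the component. Thus
  an edge far from both ends of a long component is not in E.\<close>

lemma near_end:
  assumes "R = {}" "x \<in> E" "i \<le> x" "x < q"
  shows "real_of_int (x + 1 - i) \<le> t / \<gamma> \<or> real_of_int (q - x) \<le> t / \<gamma> \<or>
    real_of_int (q - i) \<le> 2 * t / \<gamma>"
proof -
  obtain a b where ab: "i \<le> a" "a \<le> x" "x < b" "b \<le> q" "interval_comp E S a b"
    using obtain_run assms by metis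
  have "a \<in> S \<or> b \<in> S"
    using closed_free_end[OF ab(5)] ab assms by (auto simp: R_def)
  then consider "a \<in> S" "b \<in> S" | "a = i" "(a \<in> S) \<noteq> (b \<in> S)" | "b = q" "(a \<in> S) \<noteq> (b \<in> S)"
    using nonclosed_run[OF ab(5)] ab by blast
  then show ?thesis
  proof cases
    case 1
    then have "a = i" "b = q" using K_simps(3)[of a] K_simps(3)[of b] ab by auto
    then show ?thesis using run_open[OF ab(5)] 1 by simp
  qed (use run_half[OF ab(5)] ab in auto)
qed

text \<open>S misses the component, so all its runs are closed, and one of them starts at i. The
  rest, if any, is a single gap; it is half-open because q is neither in S nor a vertex of
  E.\<close>

lemma initial_run:
  assumes "i \<in> E" "i \<notin> S" "q \<notin> S" "card R \<le> 1"
  obtains s where "i < s" "s \<le> q" "E \<inter> {i..<q} = {i..<s}" "card R = 1"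
    "\<gamma> * real_of_int (q - s) \<le> t"
proof -
  have closed: "a \<notin> S" "b \<notin> S" if "interval_comp E S a b" "i \<le> a" "b \<le> q" for a b
    using nonclosed_run[OF that] assms by auto
  obtain s where s: "i < s" "s \<le> q" "interval_comp E S i s" "{i..<s} \<subseteq> E"
    using obtain_run[OF assms(1)] K_simps(1) by (smt (verit))
  have "s - 1 \<in> R" using closed_free_end[OF s(3)] closed[OF s(3)] s by (auto simp: R_def)
  moreover from this have m: "card R = 1" using assms(4) card_gt_0_iff[of R] by fastforce
  ultimately have R: "R = {s - 1}" by (auto simp: card_1_singleton_iff)
  have "x < s" if x: "x \<in> E" "i \<le> x" "x < q" for x
  proof -
    obtain a b where ab: "i \<le> a" "a \<le> x" "x < b" "b \<le> q" "interval_comp E S a b"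
      using obtain_run x by metis
    then have "b - 1 \<in> R" using closed_free_end[OF ab(5)] closed[OF ab(5)] by (auto simp: R_def)
    then show ?thesis using R ab by simp
  qed
  then have eq: "E \<inter> {i..<q} = {i..<s}" using s by auto
  have "\<gamma> * real_of_int (q - s) \<le> t"
  proof (cases "s = q")
    case True
    then show ?thesis using t_nonneg by simp
  next
    case False
    have nE: "x \<notin> E" if "s \<le> x" "x < q" for x
      using eq that s(1) by (metis IntI atLeastLessThan_iff le_less_trans less_imp_le not_less)
    then have "s \<notin> E" "q - 1 \<notin> E" "q \<notin> E" using False s K_simps(6) assms by auto
    then obtain a b where ab: "i \<le> a" "a \<le> s" "s < b" "b \<le> q"
      "interval_comp F (S \<union> ends E) a b" "a = i \<or> a - 1 \<in> E" "b = q \<or> b \<in> E" "{a..<b} \<inter> E = {}"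
      using obtain_gap[of s] s False by (metis less_le less_imp_le)
    have "s - 1 \<in> E" using s by auto
    have "a < s \<Longrightarrow> s - 1 \<in> {a..<b}" using ab by auto
    then have "\<not> a < s" using ab(8) \<open>s - 1 \<in> E\<close> by blast
    then have "a = s" using ab(2) by simp
    moreover have "b = q" using ab nE[of b] by auto
    moreover have "s \<in> ends E"
      using \<open>s - 1 \<in> E\<close> by (auto simp: ends_def intro: image_eqI[of _ _ "s - 1"])
    moreover have "q \<notin> S \<union> ends E"
      using \<open>q - 1 \<notin> E\<close> \<open>q \<notin> E\<close> assms by (auto simp: ends_def)
    ultimately have "real_of_int (q - s) \<le> t / \<gamma>" using gap_half[OF ab(5)] by blast
    then show ?thesis using \<gamma>_bounds by (simp add: field_simps)
  qed
  then show ?thesis using that s eq m by blast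
qed

end

section \<open>Budgets and the gain at a join\<close>

definition free_count :: "jtree \<Rightarrow> int set \<Rightarrow> real" where
  "free_count A S = real (card (free_ends (edges_of A) S))"

lemma Delta_on_eq: "Delta_on (graph_of A) S = free_count A S"
  by (simp add: Delta_on_def graph_of_eq Delta_minus_comps free_count_def)

definition budget :: "jtree \<Rightarrow> int set \<Rightarrow> real" where
  "budget A S = \<beta> powr (Phi A S + 1 - free_count A S)"

text \<open>Adding the vertices of a component to \<open>S\<close> leaves \<^term>\<open>free_count\<close> unchanged if the component
  is open or half-open, and lowers it by one if it is closed. Thus all three bounds of the theorem
  say that \<^term>\<open>weight\<close> times length is at most \<^term>\<open>budget\<close>, as \<open>\<gamma> = \<beta> \<delta>\<close>.\<close>

definition comps_bounded :: "jtree \<Rightarrow> bool" where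
  "comps_bounded A \<longleftrightarrow> (\<forall>S i j. finite S \<longrightarrow> interval_comp (edges_of A) S i j \<longrightarrow>
     weight S i j * real_of_int (j - i) \<le> budget A S)"

lemma comps_boundedD:
  "comps_bounded A \<Longrightarrow> finite S \<Longrightarrow> interval_comp (edges_of A) S i j \<Longrightarrow>
    weight S i j * real_of_int (j - i) \<le> budget A S"
  by (simp add: comps_bounded_def)

lemma \<beta>_gt_1: "1 < \<beta>"
  using \<gamma>_bounds by (simp add: \<beta>_eq)

lemma Phi_nonneg: "finite S \<Longrightarrow> 0 \<le> Phi A S"
  using admissibleD(1)[OF admissible_Phi] .

lemma free_count_Un:
  assumes "edges_of D = edges_of X \<union> edges_of Y"
  shows "free_count D S \<le> free_count X S + free_count Y (S \<union> verts_of X)"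
  unfolding free_count_def verts_of_eq assms of_nat_add[symmetric] of_nat_le_iff
  by (rule card_free_ends_Un) simp_all

text \<open>This is the common bound t: rule (i) bounds \<open>budget X S\<close> by it, and rule
  (ii) bounds \<open>budget Y (S \<union> verts_of X)\<close>.\<close>

definition split_budget :: "jtree \<Rightarrow> jtree \<Rightarrow> jtree \<Rightarrow> int set \<Rightarrow> real" where
  "split_budget D X Y S =
     \<beta> powr (Phi D S + 1 - free_count X S - free_count Y (S \<union> verts_of X))"

lemma edges_of_children:
  "D \<in> {Join X Y, Join Y X} \<Longrightarrow> edges_of D = edges_of X \<union> edges_of Y"
  by auto

lemma split_comp_Join:
  assumes "D \<in> {Join X Y, Join Y X}" "finite S" "interval_comp (edges_of D) S i q"
    "comps_bounded X" "comps_bounded Y"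
  shows "split_comp (edges_of X) (edges_of Y) S i q (split_budget D X Y S)"
proof
  show "interval_comp (edges_of X \<union> edges_of Y) S i q"
    using assms(3) by (simp only: edges_of_children[OF assms(1)])
  fix a b
  {
    assume "interval_comp (edges_of X) S a b"
    then have "weight S a b * real_of_int (b - a) \<le> budget X S"
      using comps_boundedD assms by blast
    also have "\<dots> \<le> split_budget D X Y S"
      unfolding budget_def split_budget_def
      using admissibleD(2)[OF admissible_Phi assms(2,1)] \<beta>_gt_1
      by (intro powr_mono) (auto simp: Delta_on_eq)
    finally show "weight S a b * real_of_int (b - a) \<le> split_budget D X Y S" .
  next
    assume "interval_comp (edges_of Y) (S \<union> ends (edges_of X)) a b"
    moreover have "finite (S \<union> verts_of X)" using assms(2) by simp
    ultimately have "weight (S \<union> verts_of X) a b * real_of_int (b - a) \<le> budget Y (S \<union> verts_of X)"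
      using comps_boundedD[OF assms(5)] by (simp only: verts_of_eq)
    also have "\<dots> \<le> split_budget D X Y S"
      unfolding budget_def split_budget_def
      using admissibleD(3)[OF admissible_Phi assms(2,1)] \<beta>_gt_1
      by (intro powr_mono) (auto simp: Delta_on_eq)
    finally show "weight (S \<union> ends (edges_of X)) a b * real_of_int (b - a) \<le> split_budget D X Y S"
      by (simp add: verts_of_eq)
  }
qed (auto simp: split_budget_def)

text \<open>The m closed runs count in Delta(X|S) but disappear when the vertices of the component
  join S, whereas the free ends of D that persist are still bounded by those of X and Y. A closed
  component takes one free end from D as well, which costs the extra \<beta>.\<close>

lemma split_budget_le:
  assumes "D \<in> {Join X Y, Join Y X}" "interval_comp (edges_of D) S i q"
    and "m = card (free_ends (edges_of X) S \<inter> {i..<q})"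
  shows "\<beta> ^ m * split_budget D X Y S \<le> (if i \<in> S \<or> q \<in> S then budget D S else \<beta> * budget D S)"
proof -
  have D: "edges_of D = edges_of X \<union> edges_of Y" using assms(1) by (rule edges_of_children)
  let ?K = "{i..q}"
  have X: "real m + free_count X (S \<union> ?K) \<le> free_count X S"
    using card_free_ends_split[of "edges_of X" S i q] assms(3)
    by (simp add: free_count_def flip: of_nat_add)
  have "free_count D (S \<union> ?K) \<le> free_count X (S \<union> ?K) + free_count Y (S \<union> ?K \<union> verts_of X)"
    by (rule free_count_Un[OF D])
  also have "free_count Y (S \<union> ?K \<union> verts_of X) \<le> free_count Y (S \<union> verts_of X)"
    unfolding free_count_def of_nat_le_iff by (rule card_free_ends_antimono) auto
  finally have XY: "real m + free_count D (S \<union> ?K) \<le> free_count X S + free_count Y (S \<union> verts_of X)"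
    using X by linarith
  have pow: "\<beta> ^ m = \<beta> powr real m" using \<beta>_gt_1 by (simp add: powr_realpow)
  show ?thesis
  proof (cases "i \<in> S \<or> q \<in> S")
    case True
    then have "free_count D S \<le> free_count D (S \<union> ?K)"
      unfolding free_count_def of_nat_le_iff using assms(2)
      by (intro card_free_ends_insert_path) (auto simp: interval_comp_def)
    then show ?thesis using True XY \<beta>_gt_1
      by (simp add: split_budget_def budget_def pow flip: powr_add)
  next
    case False
    then have "free_count D S \<le> 1 + free_count D (S \<union> ?K)"
      using card_free_ends_insert_closed[OF finite_edges_of assms(2)]
      by (simp add: free_count_def flip: of_nat_Suc)
    moreover have "\<beta> * budget D S = \<beta> powr (Phi D S + 2 - free_count D S)"
      using \<beta>_gt_1 by (simp add: budget_def powr_mult_base algebra_simps)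
    ultimately show ?thesis using False XY \<beta>_gt_1
      by (simp add: split_budget_def pow flip: powr_add)
  qed
qed

lemma interval_subset_option:
  fixes i q :: int
  assumes "{i..<q} \<subseteq> set_option l" "i < q"
  shows "l = Some i" "q = i + 1"
proof -
  have "i \<in> set_option l" using assms by (intro subsetD[OF assms(1)]) auto
  then show l: "l = Some i" by simp
  have "i + 1 \<in> set_option l" if "i + 1 < q" using that by (intro subsetD[OF assms(1)]) auto
  then show "q = i + 1" using l assms(2) by fastforce
qed

section \<open>Atoms, and components with an end in S\<close>

text \<open>The component is a single edge, so Phi \<ge> 0 suffices: the exponent in
  \<open>budget\<close> is at least 1 if an end lies in S, and at least 0 otherwise.\<close>

lemma Atom_bounded: "comps_bounded (Atom l)"
  unfolding comps_bounded_def
proof (intro allI impI)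
  fix S :: "int set" and i j
  assume fin: "finite S" and K: "interval_comp (edges_of (Atom l)) S i j"
  then have "{i..<j} \<subseteq> set_option l" "i < j" by (simp_all add: interval_comp_def)
  note l = interval_subset_option(1)[OF this] and j = interval_subset_option(2)[OF this]
  have count: "free_count (Atom l) S \<le> (if i \<in> S \<or> j \<in> S then 0 else 1)"
  proof -
    have "free_ends {i} S \<subseteq> (if i \<in> S \<or> j \<in> S then {} else {i})"
      by (auto simp: free_ends_def j intro: bexI[of _ i] bexI[of _ "i + 1"])
    from card_mono[OF _ this] show ?thesis by (auto simp: free_count_def l split: if_splits)
  qed
  have "\<gamma> \<le> \<beta> powr 1" "1 \<le> \<beta> powr 0" "\<gamma> / 2 \<le> \<beta> powr 1" using \<gamma>_bounds by (auto simp: \<beta>_eq)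
  then have "weight S i j \<le> \<beta> powr (if i \<in> S \<or> j \<in> S then 1 else 0)" by (auto simp: weight_def)
  also have "\<dots> \<le> budget (Atom l) S"
    unfolding budget_def using Phi_nonneg[OF fin, of "Atom l"] count \<beta>_gt_1
    by (intro powr_mono) (auto split: if_splits)
  finally show "weight S i j * real_of_int (j - i) \<le> budget (Atom l) S" by (simp add: j)
qed

text \<open>Either child may play the role of E. For a half-open component it is the one at the free
  end. For an open one a closed run in either child is enough; if there is none, the runs reach into
  the component from its ends only, and the length is at most twice that of a half-open run.\<close>

lemma nonclosed_Join:
  assumes XY: "comps_bounded X" "comps_bounded Y" and fin: "finite S"
    and K: "interval_comp (edges_of (Join X Y)) S i q" and S: "i \<in> S \<or> q \<in> S"
  shows "weight S i q * real_of_int (q - i) \<le> budget (Join X Y) S"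
proof -
  let ?T = "budget (Join X Y) S"
  have D: "Join X Y \<in> {Join X Y, Join Y X}" "Join X Y \<in> {Join Y X, Join X Y}" by auto
  interpret X: split_comp "edges_of X" "edges_of Y" S i q "split_budget (Join X Y) X Y S"
    by (rule split_comp_Join[OF D(1) fin K XY])
  interpret Y: split_comp "edges_of Y" "edges_of X" S i q "split_budget (Join X Y) Y X S"
    by (rule split_comp_Join[OF D(2) fin K XY(2,1)])
  have leX: "\<beta> ^ card X.R * split_budget (Join X Y) X Y S \<le> ?T"
    using split_budget_le[OF D(1) K, of "card X.R"] S by (simp add: X.R_def)
  have leY: "\<beta> ^ card Y.R * split_budget (Join X Y) Y X S \<le> ?T"
    using split_budget_le[OF D(2) K, of "card Y.R"] S by (simp add: Y.R_def)
  show ?thesis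
  proof (cases "i \<in> S \<and> q \<in> S")
    case False
    then have w: "weight S i q = \<gamma>" using S by (auto simp: weight_def)
    have "i \<in> edges_of X \<or> i \<in> edges_of Y" "q - 1 \<in> edges_of X \<or> q - 1 \<in> edges_of Y"
      using X.K_simps(1) X.K_simps(2)[of i] X.K_simps(2)[of "q - 1"] by auto
    then show ?thesis
      unfolding w using X.length_le_half Y.length_le_half leX leY S False by fastforce
  next
    case True
    then have w: "weight S i q = \<gamma> / 2" by (simp add: weight_def)
    show ?thesis
    proof (cases "X.R = {} \<and> Y.R = {}")
      case False
      then show ?thesis unfolding w using X.length_le_open Y.length_le_open leX leY by force
    next
      case R: True
      let ?L = "?T / \<gamma>"
      have tX: "split_budget (Join X Y) X Y S / \<gamma> \<le> ?L"
        "split_budget (Join X Y) Y X S / \<gamma> \<le> ?L"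
        using leX leY R \<gamma>_bounds by (auto intro!: divide_right_mono)
      have L0: "0 \<le> ?L" using \<gamma>_bounds by (simp add: budget_def)
      have "real_of_int (q - i) \<le> 2 * ?L"
      proof (rule ccontr)
        assume long: "\<not> real_of_int (q - i) \<le> 2 * ?L"
        \<comment> \<open>A point far from both ends lies in no half-open run.\<close>
        define x where "x = \<lfloor>real_of_int i + ?L\<rfloor>"
        have x: "real_of_int x \<le> real_of_int i + ?L" "real_of_int i + ?L < real_of_int x + 1"
          unfolding x_def by linarith+
        have "real_of_int x < real_of_int q - ?L" using x long by simp
        then have "i \<le> x" "x < q" using x L0 by (auto simp: x_def le_floor_iff)
        then have "x \<in> edges_of X \<or> x \<in> edges_of Y" by (rule X.K_simps(2))
        then show False
          using X.near_end[of x] Y.near_end[of x] R \<open>i \<le> x\<close> \<open>x < q\<close> tX x long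
            \<open>real_of_int x < real_of_int q - ?L\<close> by fastforce
      qed
      then show ?thesis unfolding w using \<gamma>_bounds by (simp add: field_simps)
    qed
  qed
qed

section \<open>Closed components: the descent and the golden ratio\<close>

lemma finite_verts: "finite S \<Longrightarrow> finite (S \<union> verts_of X)"
  by simp

lemma initial_segment_comp:
  assumes "interval_comp E S i j" "i \<notin> S" "j \<notin> S"
    and "G \<subseteq> E" "G \<inter> {i..<j} = {i..<q}" "i < q" "q \<le> j"
  shows "interval_comp G S i q" "q \<notin> S"
proof -
  have K: "S \<inter> {i..j} = {}" "i - 1 \<notin> E" "j \<notin> E"
    using assms(1-3) by (auto simp: interval_comp_def)
  then show "q \<notin> S" using assms(6,7) by auto
  have "q \<notin> G" using assms(4-7) K(3) by (cases "q = j") (auto simp: set_eq_iff)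
  then show "interval_comp G S i q"
    using K assms(4-7) by (auto simp: interval_comp_def)
qed

text \<open>Rule (iii) without logarithms: its average makes the product of
  \<open>budget X S\<close> and \<open>budget A (S \<union> verts_of X)\<close> at most the square
  of \<open>budget A S\<close>. Once the vertices of X are added to S, the remainder from s to j is
  half-open.\<close>

lemma cut_at_initial_segment:
  assumes A: "finite S" "interval_comp (edges_of A) S i j" "i \<notin> S" "j \<notin> S"
    and half: "\<And>S i j. finite S \<Longrightarrow> interval_comp (edges_of A) S i j \<Longrightarrow> (i \<in> S) \<noteq> (j \<in> S) \<Longrightarrow>
      \<gamma> * real_of_int (j - i) \<le> budget A S"
    and X: "X \<prec> A" "comps_bounded X" "edges_of X \<subseteq> edges_of A"
      "edges_of X \<inter> {i..<j} = {i..<s}" "i < s" "s < j"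
  shows "\<gamma> * (real_of_int (s - i) * real_of_int (j - s)) \<le> budget A S * budget A S"
proof -
  have K: "{i..<j} \<subseteq> edges_of A" "S \<inter> {i..j} = {}" "i - 1 \<notin> edges_of A" "j \<notin> edges_of A"
    using A by (auto simp: interval_comp_def)
  have inX: "x \<in> edges_of X \<longleftrightarrow> x < s" if "i \<le> x" "x < j" for x
    using X(4) that by auto
  have out: "i - 1 \<notin> edges_of X" "s \<notin> edges_of X" "s - 1 \<in> edges_of X"
    using K X(3) inX[of s] inX[of "s - 1"] X(5,6) by auto
  have compX: "interval_comp (edges_of X) S i s"
    using initial_segment_comp(1)[OF A(2-4) X(3-5)] X(6) by simp
  have sV: "s \<in> verts_of X"
    using out(3) by (auto simp: verts_of_eq ends_def intro: image_eqI[of _ _ "s - 1"])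
  \<comment> \<open>Inside the component the edges of X stop before s, and the edge j is not even in
    A; hence X has no vertex after s up to j.\<close>
  have "v = s" if "v \<in> verts_of X" "s \<le> v" "v \<le> j" for v
  proof -
    have "v \<in> edges_of X \<or> v - 1 \<in> edges_of X" using that by (auto simp: verts_of_eq ends_def)
    moreover have "v \<noteq> j \<or> v \<notin> edges_of X" using K X(3) by auto
    ultimately show ?thesis using inX[of v] inX[of "v - 1"] that X(5) by (cases "v = s") auto
  qed
  moreover from this have jV: "j \<notin> verts_of X" using X by force
  ultimately have compA: "interval_comp (edges_of A) (S \<union> verts_of X) s j"
    using K X sV by (auto simp: interval_comp_def)
  have "real_of_int (s - i) \<le> budget X S"
    using comps_boundedD[OF X(2) A(1) compX] A(3) K(2) X by (auto simp: weight_def split: if_splits)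
  moreover have "\<gamma> * real_of_int (j - s) \<le> budget A (S \<union> verts_of X)"
    using half[OF finite_verts[OF A(1)] compA] sV jV A(4) by blast
  ultimately have "real_of_int (s - i) * (\<gamma> * real_of_int (j - s))
      \<le> budget X S * budget A (S \<union> verts_of X)"
    using X \<gamma>_bounds by (intro mult_mono) (auto simp: budget_def)
  also have "\<dots> \<le> budget A S * budget A S"
  proof -
    have "free_count A S \<le> free_count X S + free_count A (S \<union> verts_of X)"
      using X(3) by (intro free_count_Un) auto
    moreover have "Phi X S + Phi A (S \<union> verts_of X) + free_count A S \<le> 2 * Phi A S"
      using admissibleD(4)[OF admissible_Phi A(1) X(1)] by (simp add: Delta_on_eq)
    ultimately show ?thesis using \<beta>_gt_1
      by (simp add: budget_def flip: powr_add)
  qed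
  finally show ?thesis by (simp add: mult.left_commute)
qed

lemma edges_of_mono: "D \<preceq> A \<Longrightarrow> edges_of D \<subseteq> edges_of A"
  by (induction rule: subtree.induct) auto

lemma subtree_size: "D \<preceq> A \<Longrightarrow> edges_of D \<noteq> {} \<Longrightarrow> size D \<le> size A"
  by (induction rule: subtree.induct) auto

lemma subtree_trans:
  assumes "B \<preceq> C" "A \<preceq> B"
  shows "A \<preceq> C"
  using assms by (induction rule: subtree.induct) (auto intro: subtree.intros elim: subtree.cases)

text \<open>The \<bottom>-labelled tree lies below every tree by definition, so properness is read
  off from the sizes of subtrees that carry an edge.\<close>

lemma strict_child:
  assumes "D \<preceq> A" "D \<in> {Join X Y, Join Y X}" "edges_of X \<noteq> {}"
  shows "X \<prec> A"
proof -
  have "X \<preceq> D" using assms(2) by (auto intro: subtree.intros)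
  then have 1: "X \<preceq> A" using subtree_trans assms(1) by blast
  have "size X < size D" "edges_of D \<noteq> {}" using assms by auto
  then have "size X < size A" using subtree_size[OF assms(1)] by simp
  then show ?thesis using 1 by (auto simp: strict_subtree_def)
qed

text \<open>With a = 1 / phi, the bound on y and 2 a - 1 = 1 / \<gamma> give x > (1 - a) k. So x
  lies strictly between (1 - a) k and a k, where x (k - x) exceeds a (1 - a) k k = k k / \<gamma>.
  In the descent, k belongs to the component of A, x to the initial piece and y to the gap cut off
  last.\<close>

lemma golden_contradiction:
  fixes x y k :: real
  assumes "(\<gamma> - 3) / 2 * k \<le> x + y" "x < (\<gamma> - 3) / 2 * k" "\<gamma> * y < k"
    and "\<gamma> * (x * (k - x)) \<le> k * k"
  shows False
proof -
  define a where "a = (\<gamma> - 3) / 2"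
  have a: "\<gamma> * (a * (1 - a)) = 1" "\<gamma> * (2 * a - 1) = 1"
    using \<gamma>_square by (simp_all add: a_def field_simps)
  have "\<gamma> * (x * (k - x)) - k * k = \<gamma> * (x * (k - x)) - (\<gamma> * (a * (1 - a))) * (k * k)"
    by (simp only: a mult_1)
  also have "\<dots> = \<gamma> * ((a * k - x) * (x - (1 - a) * k))"
    by (simp add: algebra_simps)
  finally have eq: "\<gamma> * (x * (k - x)) - k * k = \<gamma> * ((a * k - x) * (x - (1 - a) * k))" .
  have "\<gamma> * y < \<gamma> * (2 * a - 1) * k" using assms(3) by (simp only: a mult_1)
  then have "y < (2 * a - 1) * k" using \<gamma>_bounds by (simp add: mult.assoc)
  then have "0 < x - (1 - a) * k" using assms(1) by (simp add: algebra_simps flip: a_def)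
  moreover have "0 < a * k - x" using assms(2) by (simp flip: a_def)
  ultimately have "0 < \<gamma> * ((a * k - x) * (x - (1 - a) * k))"
    using \<gamma>_bounds by simp
  then show False using eq assms(4) by linarith
qed

text \<open>Here \<open>(\<gamma> - 3) / 2 = 1 / \<phi>\<close> and \<open>\<gamma> = \<phi>\<^sup>3\<close> for the golden ratio \<open>\<phi>\<close>. The descent follows
  the child containing the edge \<open>i\<close> as long as this child covers a fraction of at least
  \<open>1 / \<phi>\<close> of the component of \<open>A\<close>.\<close>

lemma descent:
  assumes A: "finite S" "interval_comp (edges_of A) S i j" "i \<notin> S" "j \<notin> S"
    and half: "\<And>S i j. finite S \<Longrightarrow> interval_comp (edges_of A) S i j \<Longrightarrow> (i \<in> S) \<noteq> (j \<in> S) \<Longrightarrow>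
      \<gamma> * real_of_int (j - i) \<le> budget A S"
    and sub: "\<And>D. D \<prec> A \<Longrightarrow> comps_bounded D"
    and short: "budget A S < real_of_int (j - i)"
    and D: "D \<preceq> A" "edges_of D \<inter> {i..<j} = {i..<q}" "i < q" "q \<le> j"
      "(\<gamma> - 3) / 2 * real_of_int (j - i) \<le> real_of_int (q - i)" "budget D S \<le> budget A S"
  shows False
  using D
proof (induction D arbitrary: q)
  case (Atom l)
  have DA: "edges_of (Atom l) \<subseteq> edges_of A" by (rule edges_of_mono[OF Atom.prems(1)])
  note comp = initial_segment_comp[OF A(2-4) DA Atom.prems(2-4)]
  have "{i..<q} \<subseteq> set_option l" using Atom.prems(2) by (metis Int_lower1 edges_of.simps(1))
  then have "q = i + 1" using Atom.prems(3) by (rule interval_subset_option(2))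
  \<comment> \<open>The single edge forces \<open>budget A S\<close> \<ge> 1, so the integer j - i
    is at least 2, and one edge is at most half of it, which is less than 1 / phi.\<close>
  then have "1 < real_of_int (j - i)" "(\<gamma> - 3) / 2 * real_of_int (j - i) \<le> 1"
    using comps_boundedD[OF Atom_bounded A(1) comp(1)] comp(2) A(3) Atom.prems(5,6) short
    by (auto simp: weight_def split: if_splits)
  moreover from this have "2 \<le> j - i" by linarith
  then have "2 \<le> real_of_int (j - i)" by linarith
  then have "(\<gamma> - 3) / 2 * 2 \<le> (\<gamma> - 3) / 2 * real_of_int (j - i)"
    using \<gamma>_bounds by (intro mult_left_mono) auto
  ultimately show False using \<gamma>_bounds by simp
next
  case (Join X Y)
  let ?D = "Join X Y"
  have DA: "edges_of ?D \<subseteq> edges_of A" by (rule edges_of_mono[OF Join.prems(1)])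
  note comp = initial_segment_comp[OF A(2-4) DA Join.prems(2-4)]
  have step: False
    if D: "?D \<in> {Join B C, Join C B}" and iB: "i \<in> edges_of B"
      and IH: "\<And>q. B \<preceq> A \<Longrightarrow> edges_of B \<inter> {i..<j} = {i..<q} \<Longrightarrow> i < q \<Longrightarrow> q \<le> j \<Longrightarrow>
        (\<gamma> - 3) / 2 * real_of_int (j - i) \<le> real_of_int (q - i) \<Longrightarrow>
        budget B S \<le> budget A S \<Longrightarrow> False" for B C
  proof -
    have BA: "B \<prec> A" using strict_child[OF Join.prems(1) D] iB by blast
    have bB: "comps_bounded B" using sub BA by blast
    have bC: "comps_bounded C"
    proof (cases "edges_of C = {}")
      case True
      then show ?thesis by (auto simp: comps_bounded_def interval_comp_def)
    next
      case False
      have "?D \<in> {Join C B, Join B C}" using D by blast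
      then show ?thesis using sub strict_child[OF Join.prems(1) _ False] by blast
    qed
    interpret B: split_comp "edges_of B" "edges_of C" S i q "split_budget ?D B C S"
      using split_comp_Join[OF D A(1) comp(1) bB bC] .
    have le: "\<beta> ^ card B.R * split_budget ?D B C S \<le> \<beta> * budget ?D S"
      using split_budget_le[OF D comp(1), of "card B.R"] A(3) comp(2) by (simp add: B.R_def)
    have "\<not> 2 \<le> card B.R"
    proof
      assume "2 \<le> card B.R"
      from B.length_le_many(2)[OF this] le
      have "\<beta> * (100 * real_of_int (q - i)) \<le> \<beta> * (61 * budget ?D S)" by (simp add: algebra_simps)
      then have "100 * real_of_int (q - i) \<le> 61 * budget ?D S" using \<beta>_gt_1 by simp
      moreover have "61 / 100 * real_of_int (j - i) \<le> (\<gamma> - 3) / 2 * real_of_int (j - i)"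
        using \<gamma>_bounds Join.prems(3,4) by (intro mult_right_mono) auto
      then have "61 / 100 * real_of_int (j - i) \<le> real_of_int (q - i)"
        using Join.prems(5) by (rule order_trans)
      ultimately have "61 * real_of_int (j - i) \<le> 61 * budget ?D S" by argo
      then show False using Join.prems(6) short by simp
    qed
    then have "card B.R \<le> 1" by simp
    then obtain s where s: "i < s" "s \<le> q" "edges_of B \<inter> {i..<q} = {i..<s}" "card B.R = 1"
      "\<gamma> * real_of_int (q - s) \<le> split_budget ?D B C S"
      using B.initial_run[OF iB A(3) comp(2)] by blast
    have "\<gamma> * real_of_int (q - s) \<le> budget ?D S" using s(4,5) le \<beta>_gt_1 by simp
    then have qs: "\<gamma> * real_of_int (q - s) < real_of_int (j - i)"
      using Join.prems(6) short by linarith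
    have BD: "edges_of B \<subseteq> edges_of ?D" using D by auto
    have Bj: "edges_of B \<inter> {i..<j} = {i..<s}"
    proof -
      have "edges_of B \<inter> {i..<j} = edges_of B \<inter> (edges_of ?D \<inter> {i..<j})" using BD by blast
      then show ?thesis by (simp only: Join.prems(2) s(3))
    qed
    \<comment> \<open>By rule (i) budgets do not grow on the way down, so the bound by
      \<open>budget A S\<close> persists.\<close>
    have budB: "budget B S \<le> budget ?D S"
      using admissibleD(2)[OF admissible_Phi A(1) D] free_count_Un[OF edges_of_children[OF D], of S] \<beta>_gt_1
      unfolding budget_def Delta_on_eq by (intro powr_mono) auto
    show False
    proof (cases "(\<gamma> - 3) / 2 * real_of_int (j - i) \<le> real_of_int (s - i)")
      case True
      show False
        using IH[OF _ Bj s(1) _ True] BA s(2) Join.prems(4,6) budB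
        by (simp add: strict_subtree_def)
    next
      case False
      have "(\<gamma> - 3) / 2 * real_of_int (j - i) \<le> 1 * real_of_int (j - i)"
        using \<gamma>_bounds Join.prems(3,4) by (intro mult_right_mono) auto
      then have "s < j" using False by simp
      have T: "0 \<le> budget A S" by (simp add: budget_def)
      have "\<gamma> * (real_of_int (s - i) * real_of_int (j - s)) \<le> budget A S * budget A S"
        using cut_at_initial_segment[OF A half BA bB _ Bj s(1) \<open>s < j\<close>] BD DA by blast
      also have "\<dots> \<le> real_of_int (j - i) * real_of_int (j - i)"
        using short T by (intro mult_mono) auto
      finally show False
        using golden_contradiction[of "real_of_int (j - i)" "real_of_int (s - i)" "real_of_int (q - s)"]
          False qs Join.prems(5) by simp
    qed
  qed
  have "i \<in> edges_of X \<or> i \<in> edges_of Y"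
    using Join.prems(2,3) by (auto simp: set_eq_iff)
  then show False using step[of X Y] step[of Y X] Join.IH by blast
qed

section \<open>The induction and the return to logarithms\<close>

text \<open>The claim covers all subtrees because the descent may apply rule (iii) to a descendant
  at any depth.\<close>

lemma subtrees_bounded: "D \<preceq> A \<Longrightarrow> comps_bounded D"
proof (induction A arbitrary: D)
  case (Atom l)
  then show ?case by (auto elim: subtree.cases simp: Atom_bounded)
next
  case (Join X Y)
  let ?A = "Join X Y"
  have sub: "comps_bounded D" if "D \<prec> ?A" for D
    using that Join.IH by (auto simp: strict_subtree_def Atom_bounded elim: subtree.cases)
  have bounded: "comps_bounded X" "comps_bounded Y" using Join.IH subtree.refl by blast+
  have half: "\<gamma> * real_of_int (j - i) \<le> budget ?A S"
    if "finite S" "interval_comp (edges_of ?A) S i j" "(i \<in> S) \<noteq> (j \<in> S)" for S i j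
    using nonclosed_Join[OF bounded that(1,2)] that(3) by (auto simp: weight_def split: if_splits)
  have "comps_bounded ?A"
    unfolding comps_bounded_def
  proof (intro allI impI)
    fix S :: "int set" and i j
    assume S: "finite S" and K: "interval_comp (edges_of ?A) S i j"
    show "weight S i j * real_of_int (j - i) \<le> budget ?A S"
    proof (cases "i \<in> S \<or> j \<in> S")
      case True
      then show ?thesis by (rule nonclosed_Join[OF bounded S K])
    next
      case False
      have ij: "i < j" "edges_of ?A \<inter> {i..<j} = {i..<j}" using K by (auto simp: interval_comp_def)
      \<comment> \<open>The descent starts at the whole tree with q = j, where the covered fraction
        is 1.\<close>
      have "(\<gamma> - 3) / 2 * real_of_int (j - i) \<le> 1 * real_of_int (j - i)"
        using \<gamma>_bounds ij(1) by (intro mult_right_mono) auto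
      then have "\<not> budget ?A S < real_of_int (j - i)"
        using descent[OF S K _ _ half sub _ subtree.refl ij(2,1)] False by auto
      then show ?thesis using False by (simp add: weight_def)
    qed
  qed
  then show ?case using sub Join.prems by (auto simp: strict_subtree_def)
qed

text \<open>The free end j - 1, lost when {i..j} joins S, cancels the summand 1 in the exponent of
  \<open>budget\<close>.\<close>

lemma Phi_ge_closed:
  assumes "finite S" "interval_comp (edges_of A) S i j" "i \<notin> S" "j \<notin> S"
  shows "log \<beta> (real_of_int (j - i)) + free_count A (S \<union> {i..j}) \<le> Phi A S"
proof -
  have ij: "i < j" using assms(2) by (simp add: interval_comp_def)
  have "j - 1 \<in> free_ends (edges_of A) S \<inter> {i..<j}"
    using closed_free_end[OF assms(2-4)] ij by simp
  then have "0 < card (free_ends (edges_of A) S \<inter> {i..<j})"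
    by (subst card_gt_0_iff) auto
  then have "free_count A (S \<union> {i..j}) + 1 \<le> free_count A S"
    using card_free_ends_split[of "edges_of A" S i j] by (simp add: free_count_def)
  then have "budget A S \<le> \<beta> powr (Phi A S - free_count A (S \<union> {i..j}))"
    unfolding budget_def using \<beta>_gt_1 by (intro powr_mono) auto
  then have "real_of_int (j - i) \<le> \<beta> powr (Phi A S - free_count A (S \<union> {i..j}))"
    using comps_boundedD[OF subtrees_bounded[OF subtree.refl] assms(1,2)] assms(3,4)
    by (simp add: weight_def)
  then have "log \<beta> (real_of_int (j - i)) \<le> Phi A S - free_count A (S \<union> {i..j})"
    using ij \<beta>_gt_1 by (subst log_le_iff) auto
  then show ?thesis by linarith
qed

text \<open>The summand 1 in the exponent remains here and becomes the division by \<beta>, which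
  turns \<gamma> into \<delta> and \<gamma> / 2 into \<epsilon> \<delta>.\<close>

lemma Phi_ge_nonclosed:
  assumes "finite S" "interval_comp (edges_of A) S i j" "i \<in> S \<or> j \<in> S"
  shows "log \<beta> (weight S i j / \<beta> * real_of_int (j - i)) + free_count A (S \<union> {i..j}) \<le> Phi A S"
proof -
  have ij: "i < j" using assms(2) by (simp add: interval_comp_def)
  have "free_count A (S \<union> {i..j}) \<le> free_count A S"
    unfolding free_count_def of_nat_le_iff by (rule card_free_ends_antimono) auto
  then have "budget A S \<le> \<beta> powr (1 + (Phi A S - free_count A (S \<union> {i..j})))"
    unfolding budget_def using \<beta>_gt_1 by (intro powr_mono) auto
  also have "\<dots> = \<beta> * \<beta> powr (Phi A S - free_count A (S \<union> {i..j}))"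
    using \<beta>_gt_1 by (simp only: powr_add powr_one)
  finally have "weight S i j * real_of_int (j - i) \<le> \<beta> * \<beta> powr (Phi A S - free_count A (S \<union> {i..j}))"
    using comps_boundedD[OF subtrees_bounded[OF subtree.refl] assms(1,2)] by linarith
  then have "weight S i j / \<beta> * real_of_int (j - i) \<le> \<beta> powr (Phi A S - free_count A (S \<union> {i..j}))"
    using \<beta>_gt_1 by (simp add: pos_divide_le_eq mult.commute)
  moreover have "0 < weight S i j / \<beta> * real_of_int (j - i)"
    using ij \<beta>_gt_1 \<gamma>_bounds by (simp add: weight_def)
  ultimately have "log \<beta> (weight S i j / \<beta> * real_of_int (j - i)) \<le> Phi A S - free_count A (S \<union> {i..j})"
    using \<beta>_gt_1 by (subst log_le_iff)
  then show ?thesis by linarith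
qed

theorem theorem6p5:
  fixes c \<delta> \<epsilon> :: real and A :: jtree and S :: "int set" and i j :: int
  assumes "c = sqrt 5 + 5" and "\<delta> = (c - 3) / c" and "\<epsilon> = 1 / 2"
    and "finite S"
    and "path_component (graph_of A) S i j"
  shows "(open_component (graph_of A) S i j \<longrightarrow>
            Phi A S \<ge> log c (\<epsilon> * \<delta> * real_of_int (j - i))
              + Delta (graph_of A \<ominus> (S \<union> verts (P_path i j)))) \<and>
         (half_open_component (graph_of A) S i j \<longrightarrow>
            Phi A S \<ge> log c (\<delta> * real_of_int (j - i))
              + Delta (graph_of A \<ominus> (S \<union> verts (P_path i j)))) \<and>
         (closed_component (graph_of A) S i j \<longrightarrow>
            Phi A S \<ge> log c (real_of_int (j - i))
              + Delta (graph_of A \<ominus> (S \<union> verts (P_path i j))))"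
proof -
  have \<delta>: "\<delta> = \<gamma> / \<beta>" and c: "c = \<beta>"
    unfolding assms(1,2) \<gamma>_def \<beta>_def by simp_all
  have \<epsilon>: "\<epsilon> * \<delta> = \<gamma> / 2 / \<beta>"
    unfolding assms(3) \<delta> by simp
  have K: "interval_comp (edges_of A) S i j"
    using assms(5) by (simp add: graph_of_eq path_component_iff)
  then have "i < j" by (simp add: interval_comp_def)
  then have d: "Delta (graph_of A \<ominus> (S \<union> verts (P_path i j))) = free_count A (S \<union> {i..j})"
    by (simp add: verts_P_path flip: Delta_on_eq Delta_on_def)
  note c = d \<epsilon> \<delta> c
  show ?thesis
    unfolding c open_component_def half_open_component_def closed_component_def
    using Phi_ge_closed[OF assms(4) K] Phi_ge_nonclosed[OF assms(4) K]
    by (auto simp: weight_def assms(3))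
qed

end
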